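(* The relation $\beta$ is compatible with the addition $\oplus$ of billiard trajectories with initial line $\mathcal O$: if $\mathbf t_1\sim_\beta\mathbf t_1'$ and $\mathbf t_2\sim_\beta\mathbf t_2'$, then $\mathbf t_1\oplus\mathbf t_2\sim_\beta\mathbf t_1'\oplus\mathbf t_2'$.
   Context: Consider in $\mathbf E^d$ the confocal family $\mathcal Q_{\lambda}:\ \sum_{i=1}^d \frac{x_i^2}{a_i-\lambda}=1$ ($a_1,\dots,a_d$ distinct reals). Let $\ell$ be a line tangent to quadrics $\mathcal Q_{\alpha_1},\dots,\mathcal Q_{\alpha_{d-1}}$ of the family, and let $\mathcal A_{\ell}$ be the set of all lines tangent to these same $d-1$ quadrics. Fix $\mathcal O\in\mathcal A_{\ell}$. Two lines intersecting at a point $P$ of a quadric $\mathcal Q$ satisfy the billiard reflection law on $\mathcal Q$ if they are coplanar with the normal to $\mathcal Q$ at $P$ and make congruent angles with it. A billiard trajectory of length $n$ is a sequence of lines $(\ell_0,\dots,\ell_n)$ in $\mathcal A_\ell$ such that $\ell_{i-1},\ell_i$ satisfy the reflection law on some quadric $\mathcal Q_i$ of the family ($1\le i\le n$); $\ell_0$ and $\ell_n$ are its initial and final segments. $\mathcal{TB}(\mathcal O)$ is the set of billiard trajectories with $\ell_0=\mathcal O$. Double reflection configuration (DRC): four lines $X_1Y_1,X_1Y_2,X_2Y_1,X_2Y_2$, where $X_1,X_2$ lie on a quadric $\mathcal Q_1$ and $Y_1,Y_2$ on a quadric $\mathcal Q_2$ of the family, such that the two lines through each of the four points satisfy the reflection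 law there (on $\mathcal Q_1$ at $X_1,X_2$, on $\mathcal Q_2$ at $Y_1,Y_2$) and the four tangent hyperplanes at these points belong to a pencil. For $\mathbf t=(\ell_0=\mathcal O,\ell_1,\dots,\ell_n)\in\mathcal{TB}(\mathcal O)$ and each $1\le k\le n$ put $\ell_k^{(k)}=\ell_k$ and, for $k-1\ge j\ge1$, let $\ell_k^{(j)}$ be the unique line that constitutes a DRC with $\ell_{j-1},\ell_j,\ell_k^{(j+1)}$. Put $\mathcal D(\mathbf t)=(\ell_1^{(1)},\dots,\ell_n^{(1)})$, an $n$-tuple of lines intersecting $\mathcal O$. $\mathcal B$ is the inverse map, assigning to an $n$-tuple of lines intersecting $\mathcal O$ the corresponding trajectory of length $n$ with initial line $\mathcal O$. The sum is $\mathbf t_1\oplus\mathbf t_2:=\mathcal B(\mathcal D(\mathbf t_1)+\mathcal D(\mathbf t_2))$, where tuples are regarded as divisors (unordered tuples with multiplicity) and added as such; changing the order in the tuple does not change the initial and final segments or the length of the trajectory. Two billiard trajectories are $\beta$-equivalent ($\sim_\beta$) if they have common initial and final segments, and they are of the same length.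
   Formalization: Lines carry a direction of travel, transported by the reflection law, also in double reflection configurations; β-equivalence requires final segments to agree with direction. For undirected lines the claim fails: d reflections at one point of O return O reversed. *)

theory Defs
  imports "HOL-Analysis.Analysis" "HOL-Library.Multiset"
begin

section \<open>Confocal quadrics\<close>

text \<open>Because \<open>x / 0 = 0\<close>, the quadric with parameter \<open>\<mu>\<close> is only meaningful when \<open>\<mu>\<close> avoids
  all \<open>a $ i\<close>.\<close>

definition confocal_params :: "real^'n \<Rightarrow> real set" where
  "confocal_params a = {\<mu>. \<forall>i. \<mu> \<noteq> a $ i}"

definition quadric :: "real^'n \<Rightarrow> real \<Rightarrow> (real^'n) set" where
  "quadric a \<mu> = {x. (\<Sum>i\<in>UNIV. (x $ i)\<^sup>2 / (a $ i - \<mu>)) = 1}"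

text \<open>Half the gradient of the defining equation; it is nonzero at every point of the quadric.\<close>

definition normal_vec :: "real^'n \<Rightarrow> real \<Rightarrow> real^'n \<Rightarrow> real^'n" where
  "normal_vec a \<mu> x = (\<chi> i. x $ i / (a $ i - \<mu>))"

definition normal_line :: "real^'n \<Rightarrow> real \<Rightarrow> real^'n \<Rightarrow> (real^'n) set" where
  "normal_line a \<mu> x = {x + t *\<^sub>R normal_vec a \<mu> x | t. True}"

definition tangent_hyperplane :: "real^'n \<Rightarrow> real \<Rightarrow> real^'n \<Rightarrow> (real^'n) set" where
  "tangent_hyperplane a \<mu> x = {y. normal_vec a \<mu> x \<bullet> (y - x) = 0}"

section \<open>Lines tangent to quadrics, directed lines\<close>

definition is_line :: "(real^'n) set \<Rightarrow> bool" where
  "is_line L \<longleftrightarrow> affine L \<and> aff_dim L = 1"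

definition tangent_to_quadric :: "real^'n \<Rightarrow> real \<Rightarrow> (real^'n) set \<Rightarrow> bool" where
  "tangent_to_quadric a \<mu> L \<longleftrightarrow> (\<exists>x \<in> L \<inter> quadric a \<mu>. L \<subseteq> tangent_hyperplane a \<mu> x)"

definition common_tangent_lines :: "real^'n \<Rightarrow> real set \<Rightarrow> (real^'n) set set" where
  "common_tangent_lines a A = {L. is_line L \<and> (\<forall>\<alpha>\<in>A. tangent_to_quadric a \<alpha> L)}"

definition unit_direction :: "(real^'n) set \<Rightarrow> real^'n \<Rightarrow> bool" where
  "unit_direction L u \<longleftrightarrow> norm u = 1 \<and> (\<forall>x\<in>L. x + u \<in> L)"

text \<open>The segments of a trajectory are lines together with the direction in which they are
  traversed. Without the direction the line that completes a double reflection configuration is not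
  unique in the plane, where any two intersecting tangents of a conic satisfy the reflection law on
  both confocal conics through their common point, and the final segment of a sum would depend on
  more than the final segments of the summands: reflecting successively on all quadrics
  of the family through a point of a line gives back that line with the opposite direction.\<close>

type_synonym 'n dline = "(real^'n) set \<times> (real^'n)"

definition is_dline :: "('n::finite) dline \<Rightarrow> bool" where
  "is_dline l \<longleftrightarrow> is_line (fst l) \<and> unit_direction (fst l) (snd l)"

section \<open>The billiard reflection law\<close>

text \<open>The angle between two lines is the nonobtuse one, hence the absolute values.\<close>

definition reflection_law ::
    "real^'n \<Rightarrow> real \<Rightarrow> real^'n \<Rightarrow> (real^'n) set \<Rightarrow> (real^'n) set \<Rightarrow> bool" where
  "reflection_law a \<mu> P L L' \<longleftrightarrow>
     is_line L \<and> is_line L' \<and> P \<in> quadric a \<mu> \<and> P \<in> L \<and> P \<in> L' \<and>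
     coplanar (L \<union> L' \<union> normal_line a \<mu> P) \<and>
     (\<exists>u u'. unit_direction L u \<and> unit_direction L' u' \<and>
        \<bar>u \<bullet> normal_vec a \<mu> P\<bar> = \<bar>u' \<bullet> normal_vec a \<mu> P\<bar>)"

definition mirror :: "real^'n \<Rightarrow> real^'n \<Rightarrow> real^'n" where
  "mirror n u = u - (2 * (u \<bullet> n) / (n \<bullet> n)) *\<^sub>R n"

text \<open>For two different lines satisfying \<open>reflection_law\<close>, each direction of one of them has
  as mirror image a direction of the other. A line satisfies the directed law with itself only
  when it is tangent to the quadric (unchanged direction) or normal to it (reversed direction).\<close>

definition dreflection_law ::
    "real^'n \<Rightarrow> real \<Rightarrow> real^'n \<Rightarrow> 'n dline \<Rightarrow> 'n dline \<Rightarrow> bool" where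
  "dreflection_law a \<mu> P l m \<longleftrightarrow>
     is_dline l \<and> is_dline m \<and> reflection_law a \<mu> P (fst l) (fst m) \<and>
     snd m = mirror (normal_vec a \<mu> P) (snd l)"

lemma line_eq:
  assumes "is_line L" and "P \<in> L" and "unit_direction L u"
  shows "L = range (\<lambda>t. P + t *\<^sub>R u)"
proof -
  have "affine hull {P, P + u} = L"
  proof (rule affine_dim_equal)
    show "affine hull {P, P + u} \<subseteq> L"
      using assms by (intro hull_minimal) (auto simp: is_line_def unit_direction_def)
    have "u \<noteq> 0" using assms(3) by (auto simp: unit_direction_def)
    then show "aff_dim (affine hull {P, P + u}) = aff_dim L"
      using assms(1) by (simp add: is_line_def)
  qed (use assms(1) in \<open>auto simp: is_line_def\<close>)
  then show ?thesis by (simp add: affine_hull_2_alt)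
qed

lemma normal_vec_nonzero:
  assumes "P \<in> quadric a \<mu>"
  shows "normal_vec a \<mu> P \<noteq> 0"
proof
  assume "normal_vec a \<mu> P = 0"
  then have "(P $ i)\<^sup>2 / (a $ i - \<mu>) = 0" for i
    by (auto simp: normal_vec_def vec_eq_iff)
  then have "(\<Sum>i\<in>UNIV. (P $ i)\<^sup>2 / (a $ i - \<mu>)) = 0" by (intro sum.neutral) blast
  then show False using assms by (simp add: quadric_def)
qed

lemma unit_mirror_cases:
  fixes u u' n :: "real^'n"
  assumes n: "n \<noteq> 0" and u: "norm u = 1" and u': "norm u' = 1"
    and co: "dim {u, u', n} \<le> 2" and ang: "\<bar>u \<bullet> n\<bar> = \<bar>u' \<bullet> n\<bar>"
    and ne: "u' \<noteq> u" "u' \<noteq> - u"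
  shows "u' = mirror n u \<or> u' = - mirror n u"
proof -
  have uu: "u \<bullet> u = 1" "u' \<bullet> u' = 1" using u u' by (simp_all add: norm_eq_1)
  define N c where "N = n \<bullet> n" and "c = u \<bullet> n"
  have N: "N > 0" using n by (simp add: N_def)
  have ni: "u' \<notin> span {u}"
  proof
    assume "u' \<in> span {u}"
    then obtain k where k: "u' = k *\<^sub>R u" by (auto simp: span_singleton)
    then have "k\<^sup>2 = 1" using uu by (simp add: power2_eq_square)
    then show False using k ne by (auto simp: power2_eq_1_iff)
  qed
  have ind: "independent {u', u}"
    using ni u by (auto simp: independent_insert)
  have "u' \<noteq> u" by (rule ne)
  have "n \<in> span {u', u}"
  proof (rule ccontr)
    assume a: "n \<notin> span {u', u}"
    then have "independent {n, u', u}" using ind by (rule independent_insertI)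
    moreover have "card {n, u', u} = 3"
      using a \<open>u' \<noteq> u\<close> span_base[of n "{u', u}"] by (auto simp: card_insert_if)
    ultimately have "dim {n, u', u} = 3" by (simp add: dim_eq_card_independent)
    moreover have "{n, u', u} = {u, u', n}" by auto
    ultimately show False using co by simp
  qed
  then obtain \<alpha> \<beta> where e: "n = \<alpha> *\<^sub>R u' + \<beta> *\<^sub>R u"
    by (auto simp: span_insert span_singleton) (metis add.commute diff_add_cancel diff_eq_eq)
  define g where "g = u \<bullet> u'"
  have g: "g \<noteq> 1" "g \<noteq> -1"
  proof -
    have "(u - u') \<bullet> (u - u') = 2 - 2 * g" "(u + u') \<bullet> (u + u') = 2 + 2 * g"
      by (simp_all add: g_def inner_diff inner_add uu inner_commute)
    moreover have "u - u' \<noteq> 0" "u + u' \<noteq> 0"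
      using ne by (auto simp: add_eq_0_iff2 add_eq_0_iff)
    ultimately show "g \<noteq> 1" "g \<noteq> -1" by (smt (verit) inner_eq_zero_iff)+
  qed
  have c: "c = \<alpha> * g + \<beta>" "u' \<bullet> n = \<alpha> + \<beta> * g"
    by (simp_all add: c_def e g_def inner_add uu inner_commute)
  have sq: "(\<alpha> * g + \<beta>)\<^sup>2 = (\<alpha> + \<beta> * g)\<^sup>2"
    using ang c by (metis c_def power2_abs)
  have "(\<alpha>\<^sup>2 - \<beta>\<^sup>2) * (1 - g\<^sup>2) = 0"
    using sq by (simp add: power2_eq_square algebra_simps)
  moreover have "1 - g\<^sup>2 \<noteq> 0" using g by (metis eq_iff_diff_eq_0 power2_eq_1_iff)
  ultimately have "\<alpha>\<^sup>2 = \<beta>\<^sup>2" by simp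
  then have ab: "\<beta> = \<alpha> \<or> \<beta> = - \<alpha>" by (metis power2_eq_iff)
  have a0: "\<alpha> \<noteq> 0" using ab n e by auto
  have NN: "N = \<alpha>\<^sup>2 + 2 * \<alpha> * \<beta> * g + \<beta>\<^sup>2"
    by (simp add: N_def e g_def inner_add uu inner_commute power2_eq_square algebra_simps)
  from ab show ?thesis
  proof
    assume b: "\<beta> = \<alpha>"
    have "N = \<alpha> * (2 * c)" unfolding NN c(1) b by (simp add: power2_eq_square algebra_simps)
    then have "2 * c / N = 1 / \<alpha>" using N a0 by (auto simp: field_simps)
    then have "mirror n u = u - (1 / \<alpha>) *\<^sub>R n" by (simp add: mirror_def c_def N_def)
    also have "\<dots> = - u'" using a0 by (simp add: e b algebra_simps)
    finally show ?thesis by simp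
  next
    assume b: "\<beta> = - \<alpha>"
    have "N = - \<alpha> * (2 * c)" unfolding NN c(1) b by (simp add: power2_eq_square algebra_simps)
    then have "2 * c / N = - 1 / \<alpha>" using N a0 by (auto simp: field_simps)
    then have "mirror n u = u + (1 / \<alpha>) *\<^sub>R n" by (simp add: mirror_def c_def N_def)
    also have "\<dots> = u'" using a0 by (simp add: e b algebra_simps)
    finally show ?thesis by simp
  qed
qed

lemma mirror_direction:
  fixes a :: "real^'n"
  assumes law: "reflection_law a \<mu> P L L'" and ne: "L \<noteq> L'" and u: "unit_direction L u"
  shows "unit_direction L' (mirror (normal_vec a \<mu> P) u)"
proof -
  define n where "n = normal_vec a \<mu> P"
  obtain v w where L: "is_line L" "is_line L'" "P \<in> quadric a \<mu>" "P \<in> L" "P \<in> L'"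
    and co: "coplanar (L \<union> L' \<union> normal_line a \<mu> P)"
    and v: "unit_direction L v" and w: "unit_direction L' w" and ang: "\<bar>v \<bullet> n\<bar> = \<bar>w \<bullet> n\<bar>"
    using law unfolding reflection_law_def n_def by blast
  have n0: "n \<noteq> 0" using normal_vec_nonzero[OF L(3)] by (simp add: n_def)
  note eq = line_eq[OF L(1,4) v] line_eq[OF L(1,4) u] line_eq[OF L(2,5) w]
  have nv: "norm v = 1" "norm w = 1" "norm u = 1" using v w u by (auto simp: unit_direction_def)
  have neg: "unit_direction L' (- w)"
    unfolding unit_direction_def
  proof (intro conjI ballI)
    fix x assume "x \<in> L'"
    then obtain t where "x = P + t *\<^sub>R w" using eq(3) by auto
    then have "x + - w = P + (t - 1) *\<^sub>R w" by (simp add: algebra_simps)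
    then show "x + - w \<in> L'" using eq(3) by auto
  qed (use nv in auto)
  have uv: "u = v \<or> u = - v"
  proof -
    have "P + u \<in> L" using eq(2) by (metis rangeI scaleR_one)
    then obtain t where "P + u = P + t *\<^sub>R v" using eq(1) by blast
    then have t: "u = t *\<^sub>R v" by simp
    then have "\<bar>t\<bar> = 1" using nv by simp
    then show ?thesis using t by (auto simp: abs_if split: if_splits)
  qed
  have wu: "w \<noteq> u" "w \<noteq> - u"
  proof -
    show "w \<noteq> u" using eq ne by auto
    show "w \<noteq> - u"
    proof
      assume "w = - u"
      then have "P + t *\<^sub>R w = P + (- t) *\<^sub>R u" for t by simp
      then have "L' \<subseteq> L" using eq by (smt (verit) image_subset_iff rangeI)
      moreover have "aff_dim L' = aff_dim L" "affine L" "affine L'" using L by (auto simp: is_line_def)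
      ultimately show False using ne affine_dim_equal L(5) by blast
    qed
  qed
  have "{P, P + u, P + w, P + n} \<subseteq> L \<union> L' \<union> normal_line a \<mu> P"
  proof -
    have "P + u \<in> L" "P + w \<in> L'"  using L u w by (auto simp: unit_direction_def)
    moreover have "P + n \<in> normal_line a \<mu> P"
      unfolding normal_line_def n_def by (smt (verit) mem_Collect_eq scaleR_one)
    ultimately show ?thesis using L by auto
  qed
  moreover obtain x y z where "L \<union> L' \<union> normal_line a \<mu> P \<subseteq> affine hull {x, y, z}"
    using co unfolding coplanar_def by blast
  ultimately have "{P, P + u, P + w, P + n} \<subseteq> affine hull {x, y, z}" by blast
  then have "aff_dim {P, P + u, P + w, P + n} \<le> aff_dim {x, y, z}"
    by (metis aff_dim_affine_hull aff_dim_subset)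
  also have "\<dots> \<le> 2"
    using aff_dim_le_card[of "{x, y, z}"] card_length[of "[x, y, z]"] by simp
  finally have "aff_dim {P, P + u, P + w, P + n} \<le> 2" .
  moreover have "aff_dim {P, P + u, P + w, P + n} = aff_dim ((+) (- P) ` {P, P + u, P + w, P + n})"
    by (rule aff_dim_translation_eq[symmetric])
  moreover have "(+) (- P) ` {P, P + u, P + w, P + n} = insert 0 {u, w, n}" by auto
  ultimately have "aff_dim (insert 0 {u, w, n}) \<le> 2" by simp
  then have "dim {u, w, n} \<le> 2"
    using aff_dim_zero[of "insert 0 {u, w, n}"] by (simp add: hull_inc) (metis dim_span span_insert_0)
  moreover have "\<bar>u \<bullet> n\<bar> = \<bar>w \<bullet> n\<bar>" using ang uv by auto
  ultimately have "w = mirror n u \<or> w = - mirror n u"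
    using unit_mirror_cases[OF n0, of u w] nv wu by blast
  then show ?thesis using w neg n_def by auto
qed

section \<open>Billiard trajectories\<close>

definition trajectories :: "real^'n \<Rightarrow> real set \<Rightarrow> 'n dline \<Rightarrow> 'n dline list set" where
  "trajectories a A l0 = {t. t \<noteq> [] \<and> hd t = l0 \<and>
     (\<forall>l\<in>set t. is_dline l \<and> fst l \<in> common_tangent_lines a A) \<and>
     (\<forall>i. Suc i < length t \<longrightarrow>
        (\<exists>\<mu>\<in>confocal_params a. \<exists>P. dreflection_law a \<mu> P (t ! i) (t ! Suc i)))}"

definition traj_length :: "'a list \<Rightarrow> nat" where
  "traj_length t = length t - 1"

definition beta_equiv :: "'n dline list \<Rightarrow> 'n dline list \<Rightarrow> bool" where
  "beta_equiv t t' \<longleftrightarrow> hd t = hd t' \<and> last t = last t' \<and> traj_length t = traj_length t'"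

section \<open>Double reflection configurations\<close>

text \<open>A pencil consists of the hyperplanes whose equations \<open>w \<bullet> y = c\<close> are linear combinations
  of two fixed equations; its members may be parallel.\<close>

definition in_pencil :: "(real^'n) set set \<Rightarrow> bool" where
  "in_pencil Hs \<longleftrightarrow>
     (\<exists>p q :: (real^'n) \<times> real. \<forall>H\<in>Hs. \<exists>w c. w \<noteq> 0 \<and> H = {y. w \<bullet> y = c} \<and> (w, c) \<in> span {p, q})"

text \<open>In \<open>drc a l11 l12 l21 l22\<close>, the reflection laws make \<open>lij\<close> a line through \<open>Xi\<close> and
  \<open>Yj\<close>, hence the line joining them if they differ. They may coincide, as they do for two
  consecutive reflections on one quadric. At least two of the tangent hyperplanes have to be
  distinct, so that they determine a pencil: four coinciding hyperplanes would
  impose no condition on the configuration.\<close>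

definition drc ::
    "real^'n \<Rightarrow> 'n dline \<Rightarrow> 'n dline \<Rightarrow> 'n dline \<Rightarrow> 'n dline \<Rightarrow> bool" where
  "drc a l11 l12 l21 l22 \<longleftrightarrow>
     (\<exists>\<mu>\<in>confocal_params a. \<exists>\<nu>\<in>confocal_params a. \<exists>X1 X2 Y1 Y2.
        dreflection_law a \<mu> X1 l11 l12 \<and> dreflection_law a \<mu> X2 l21 l22 \<and>
        dreflection_law a \<nu> Y1 l11 l21 \<and> dreflection_law a \<nu> Y2 l12 l22 \<and>
        (let Hs = {tangent_hyperplane a \<mu> X1, tangent_hyperplane a \<mu> X2,
                   tangent_hyperplane a \<nu> Y1, tangent_hyperplane a \<nu> Y2}
         in in_pencil Hs \<and> card Hs \<ge> 2))"

text \<open>\<open>m\<close> is the unique line that constitutes a configuration with \<open>k\<close>, \<open>l\<close>, \<open>l'\<close>, where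
  both \<open>k\<close> and \<open>l'\<close> are reflections of \<open>l\<close>; thus \<open>l\<close> and \<open>m\<close> are opposite.\<close>

definition drc_completion ::
    "real^'n \<Rightarrow> 'n dline \<Rightarrow> 'n dline \<Rightarrow> 'n dline \<Rightarrow> 'n dline \<Rightarrow> bool" where
  "drc_completion a k l l' m \<longleftrightarrow> drc a l k l' m \<and> (\<forall>m'. drc a l k l' m' \<longrightarrow> m' = m)"

section \<open>The tuple of a trajectory and the sum of trajectories\<close>

text \<open>\<open>dtuple a t ds\<close> says that the tuple \<open>\<D>(t)\<close> is defined and equals \<open>ds\<close>; the
  line with lower index \<open>k\<close> and upper index \<open>j\<close> in its construction is \<open>L k j\<close>. As \<open>\<B>\<close> is the
  inverse of \<open>\<D>\<close>, \<open>dtuple a t ds\<close> also says that \<open>\<B>\<close> assigns \<open>t\<close> to \<open>ds\<close>. In special positions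
  (e.g. when a point of a completing configuration lies at infinity) there is no such \<open>ds\<close>.\<close>

definition dtuple :: "real^'n \<Rightarrow> 'n dline list \<Rightarrow> 'n dline list \<Rightarrow> bool" where
  "dtuple a t ds \<longleftrightarrow> t \<noteq> [] \<and> length ds = traj_length t \<and>
     (\<exists>L :: nat \<Rightarrow> nat \<Rightarrow> 'n dline. \<forall>k\<in>{1..traj_length t}.
        L k k = t ! k \<and>
        (\<forall>j\<in>{1..<k}. drc_completion a (t ! (j - 1)) (t ! j) (L k (Suc j)) (L k j)) \<and>
        ds ! (k - 1) = L k 1)"

text \<open>\<open>t\<close> is a sum of \<open>t1\<close> and \<open>t2\<close>. Tuples are added as divisors, so that \<open>t\<close> is determined
  only up to the order of its tuple.\<close>

definition is_sum ::
    "real^'n \<Rightarrow> real set \<Rightarrow> 'n dline \<Rightarrow> 'n dline list \<Rightarrow> 'n dline list \<Rightarrow> 'n dline list \<Rightarrow> bool" where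
  "is_sum a A l0 t1 t2 t \<longleftrightarrow>
     {t1, t2, t} \<subseteq> trajectories a A l0 \<and>
     (\<exists>ds1 ds2 ds. dtuple a t1 ds1 \<and> dtuple a t2 ds2 \<and> dtuple a t ds \<and>
        mset ds = mset ds1 + mset ds2)"

end

theory Submission
  imports Defs "HOL-Library.Landau_Symbols"
begin

text \<open>
  The lines tangent to the given quadrics share a hyperelliptic spectral curve
  \<open>y\<^sup>2 = line_disc a x v \<kappa>\<close>, the discriminant of the quadratic equation for the intersections of
  the line with the quadric of parameter \<open>\<kappa>\<close>. A reflection at a point of the quadric of parameter
  \<open>\<mu>\<close> picks one of the two points of the curve over \<open>\<mu>\<close>; it acts on the coordinate vectors
  \<open>(x\<^sub>i, v\<^sub>i)\<close> of the line by the values at \<open>a\<^sub>i\<close> of a rational matrix function that intertwines the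
  Lax matrices of the two lines and whose divisor is given by that point. The pencil condition says
  that opposite reflections of a double reflection configuration belong to the same point, so the
  divisor of a trajectory is determined by its tuple, and divisors of sums add up. If
  \<open>M\<^sub>1, M\<^sub>1', M\<^sub>2, M\<^sub>2', M, M'\<close> belong to two pairs of equivalent trajectories and to their sums, then
  \<open>M M\<^sub>1\<^sup>-\<^sup>1 M\<^sub>1' M\<^sub>2\<^sup>-\<^sup>1 M\<^sub>2' M'\<^sup>-\<^sup>1\<close> leads from the final segment of the second sum to that of the first one
  and has no poles, hence it is a constant that only moves the base point of the line. This is the
  addition on the Jacobian of the curve, without constructing the Jacobian.
\<close>

section \<open>Confocal forms and discriminants\<close>

definition confocal_form :: "real^'n \<Rightarrow> real \<Rightarrow> real^'n \<Rightarrow> real^'n \<Rightarrow> real" where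
  "confocal_form a \<mu> x y = (\<Sum>i\<in>UNIV. x $ i * y $ i / (a $ i - \<mu>))"

lemma confocal_form_commute: "confocal_form a \<mu> x y = confocal_form a \<mu> y x"
  by (simp add: confocal_form_def mult.commute)

lemma confocal_form_linear [simp]:
  "confocal_form a \<mu> (x + y) z = confocal_form a \<mu> x z + confocal_form a \<mu> y z"
  "confocal_form a \<mu> z (x + y) = confocal_form a \<mu> z x + confocal_form a \<mu> z y"
  "confocal_form a \<mu> (x - y) z = confocal_form a \<mu> x z - confocal_form a \<mu> y z"
  "confocal_form a \<mu> z (x - y) = confocal_form a \<mu> z x - confocal_form a \<mu> z y"
  "confocal_form a \<mu> (r *\<^sub>R x) z = r * confocal_form a \<mu> x z"
  "confocal_form a \<mu> z (r *\<^sub>R x) = r * confocal_form a \<mu> z x"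
  by (simp_all add: confocal_form_def sum.distrib[symmetric] sum_subtractf[symmetric]
      sum_distrib_left add_divide_distrib[symmetric] diff_divide_distrib[symmetric] algebra_simps)

lemma quadric_iff: "x \<in> quadric a \<mu> \<longleftrightarrow> confocal_form a \<mu> x x = 1"
  by (simp add: quadric_def confocal_form_def power2_eq_square)

lemma normal_vec_inner: "normal_vec a \<mu> x \<bullet> y = confocal_form a \<mu> x y"
  by (simp add: normal_vec_def confocal_form_def inner_vec_def)

lemma inner_own_normal_vec: "x \<in> quadric a \<mu> \<Longrightarrow> x \<bullet> normal_vec a \<mu> x = 1"
  unfolding inner_commute[of x] normal_vec_inner quadric_iff .

text \<open>Partial fractions in every coordinate:
  \<open>1 / ((a $ i - \<mu>) * (a $ i - \<kappa>))\<close> is the difference of two simple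
  fractions divided by \<open>\<kappa> - \<mu>\<close>.\<close>

lemma confocal_form_normal_vec:
  assumes "\<kappa> \<in> confocal_params a" "\<mu> \<in> confocal_params a" "\<kappa> \<noteq> \<mu>"
  shows "confocal_form a \<kappa> x (normal_vec a \<mu> y) =
    (confocal_form a \<kappa> x y - confocal_form a \<mu> x y) / (\<kappa> - \<mu>)"
proof -
  have "x $ i * (y $ i / (a $ i - \<mu>)) / (a $ i - \<kappa>) =
      (x $ i * y $ i / (a $ i - \<kappa>) - x $ i * y $ i / (a $ i - \<mu>)) / (\<kappa> - \<mu>)" for i
  proof -
    define p A B where "p = x $ i * y $ i" and "A = a $ i - \<kappa>" and "B = a $ i - \<mu>"
    have nz: "A \<noteq> 0" "B \<noteq> 0" "\<kappa> - \<mu> = B - A" "B - A \<noteq> 0"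
      using assms unfolding A_def B_def confocal_params_def by (auto dest: spec[of _ i])
    have "p / A - p / B = p * (B - A) / (A * B)"
      using nz(1,2) by (simp add: diff_frac_eq right_diff_distrib)
    then have "(p / A - p / B) / (B - A) = p / B / A"
      using nz(1,2,4) by simp
    then show ?thesis unfolding nz(3) by (simp add: p_def A_def B_def)
  qed
  then show ?thesis
    by (simp add: confocal_form_def normal_vec_def sum_subtractf[symmetric] sum_divide_distrib)
qed

text \<open>The discriminant of \<open>t \<mapsto> confocal_form a \<mu> (x + t v) (x + t v) - 1\<close> up to a factor 4.\<close>

definition line_disc :: "real^'n \<Rightarrow> real^'n \<Rightarrow> real^'n \<Rightarrow> real \<Rightarrow> real" where
  "line_disc a x v \<mu> =
     (confocal_form a \<mu> x v)\<^sup>2 - confocal_form a \<mu> v v * (confocal_form a \<mu> x x - 1)"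

lemma line_disc_shift: "line_disc a (x + t *\<^sub>R v) v \<mu> = line_disc a x v \<mu>"
  by (simp add: line_disc_def power2_eq_square confocal_form_commute[of a \<mu> v x] algebra_simps)

text \<open>At a point of the quadric the constant coefficient vanishes, so the discriminant is a
  square. When it is not zero, the sign of \<open>normal_vec a \<mu> x \<bullet> v\<close> singles
  out one of the two points of the spectral curve over \<mu>.\<close>

lemma line_disc_at: "x \<in> quadric a \<mu> \<Longrightarrow> line_disc a x v \<mu> = (normal_vec a \<mu> x \<bullet> v)\<^sup>2"
  by (simp add: line_disc_def quadric_iff normal_vec_inner)

section \<open>Effect of a reflection on forms and discriminants\<close>

lemma mirror_inner: "n \<noteq> 0 \<Longrightarrow> n \<bullet> mirror n v = - (n \<bullet> v)"
  by (simp add: mirror_def inner_diff_right inner_commute)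

text \<open>By partial fractions the normal \<open>n\<close> acts in the form with parameter
  \<kappa> like \<open>x / (\<kappa> - \<mu>)\<close>, up to terms evaluated at \<mu>. The
  coefficient of a reflection is the one for which these terms cancel, so the effect is that of
  replacing \<open>v\<close> by \<open>v - f x\<close>, with
  \<open>confocal_form a \<kappa> x x - 1\<close> as the square of \<open>x\<close>.\<close>

lemma reflected_forms:
  fixes a x v :: "real^'n"
  assumes "\<kappa> \<in> confocal_params a" "\<mu> \<in> confocal_params a" "\<kappa> \<noteq> \<mu>" "x \<in> quadric a \<mu>"
  defines "n \<equiv> normal_vec a \<mu> x"
  defines "f \<equiv> 2 * (v \<bullet> n) / (n \<bullet> n) / (\<kappa> - \<mu>)"
  shows "confocal_form a \<kappa> x (mirror n v) = confocal_form a \<kappa> x v - f * (confocal_form a \<kappa> x x - 1)"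
    and "confocal_form a \<kappa> (mirror n v) (mirror n v) =
      confocal_form a \<kappa> v v - 2 * f * confocal_form a \<kappa> x v + f\<^sup>2 * (confocal_form a \<kappa> x x - 1)"
proof -
  have nn: "n \<bullet> n \<noteq> 0" using normal_vec_nonzero[OF assms(4)] by (simp add: n_def)
  have b: "v \<bullet> n = confocal_form a \<mu> x v"
    unfolding n_def inner_commute[of v] by (rule normal_vec_inner)
  have xn: "confocal_form a \<kappa> x n = (confocal_form a \<kappa> x x - 1) / (\<kappa> - \<mu>)"
    using assms by (simp add: n_def confocal_form_normal_vec quadric_iff)
  have vn: "confocal_form a \<kappa> v n = (confocal_form a \<kappa> x v - v \<bullet> n) / (\<kappa> - \<mu>)"
    using assms(1-3) unfolding b
    by (simp add: n_def confocal_form_normal_vec confocal_form_commute[of a _ v x])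
  have nn': "confocal_form a \<kappa> n n = (confocal_form a \<kappa> x n - n \<bullet> n) / (\<kappa> - \<mu>)"
  proof -
    have "confocal_form a \<mu> n x = n \<bullet> n"
      by (metis n_def confocal_form_commute normal_vec_inner)
    then show ?thesis
      using confocal_form_normal_vec[OF assms(1-3), of n x]
      unfolding n_def[symmetric] confocal_form_commute[of a \<kappa> n x] by simp
  qed
  define c where "c = 2 * (v \<bullet> n) / (n \<bullet> n)"
  have cn: "c * (n \<bullet> n) = 2 * (v \<bullet> n)" using nn by (simp add: c_def)
  have m: "mirror n v = v - c *\<^sub>R n" by (simp add: mirror_def c_def)
  have f: "f = c / (\<kappa> - \<mu>)" by (simp add: f_def c_def)
  show "confocal_form a \<kappa> x (mirror n v) = confocal_form a \<kappa> x v - f * (confocal_form a \<kappa> x x - 1)"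
    by (simp add: m xn f)
  have "confocal_form a \<kappa> (mirror n v) (mirror n v) =
      confocal_form a \<kappa> v v - 2 * c * confocal_form a \<kappa> v n + c * c * confocal_form a \<kappa> n n"
    by (simp add: m confocal_form_commute[of a \<kappa> n v] algebra_simps)
  also have "c * c * confocal_form a \<kappa> n n =
      f\<^sup>2 * (confocal_form a \<kappa> x x - 1) - c / (\<kappa> - \<mu>) * (c * (n \<bullet> n))"
    by (simp add: nn' xn f power2_eq_square divide_inverse algebra_simps)
  also have "c / (\<kappa> - \<mu>) * (c * (n \<bullet> n)) = 2 * f * (v \<bullet> n)" by (simp add: cn f)
  also have "2 * c * confocal_form a \<kappa> v n = 2 * f * (confocal_form a \<kappa> x v - v \<bullet> n)"
    by (simp add: vn f)
  finally show "confocal_form a \<kappa> (mirror n v) (mirror n v) =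
      confocal_form a \<kappa> v v - 2 * f * confocal_form a \<kappa> x v + f\<^sup>2 * (confocal_form a \<kappa> x x - 1)"
    by (simp add: algebra_simps)
qed

text \<open>This is the invariance of caustics. On the reflecting quadric the normal component only
  changes its sign; for other parameters \<open>reflected_forms\<close> describes a unimodular
  substitution in a binary quadratic form, which preserves the discriminant.\<close>

lemma line_disc_mirror:
  assumes "\<kappa> \<in> confocal_params a" "\<mu> \<in> confocal_params a" "x \<in> quadric a \<mu>"
  shows "line_disc a x (mirror (normal_vec a \<mu> x) v) \<kappa> = line_disc a x v \<kappa>"
proof (cases "\<kappa> = \<mu>")
  case True
  then show ?thesis
    using assms by (simp add: line_disc_at mirror_inner normal_vec_nonzero)
next
  case False
  show ?thesis
    unfolding line_disc_def reflected_forms[OF assms(1,2) False assms(3)]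
    by (simp add: power2_eq_square algebra_simps)
qed

section \<open>Normals of a line that touches a quadric\<close>

lemma normal_vec_inverse:
  "\<mu> \<in> confocal_params a \<Longrightarrow> X $ i = (a $ i - \<mu>) * normal_vec a \<mu> X $ i"
  by (simp add: confocal_params_def normal_vec_def) (metis eq_iff_diff_eq_0)

lemma normal_vec_inject:
  "\<mu> \<in> confocal_params a \<Longrightarrow> normal_vec a \<mu> X = normal_vec a \<mu> Y \<Longrightarrow> X = Y"
  by (metis normal_vec_inverse vec_eq_iff)

text \<open>A point is the image of its normal under the diagonal matrix with entries
  \<open>a $ i - \<mu>\<close>. Thus points can be eliminated in favour of normals, and \<mu> enters
  only linearly.\<close>

lemma inner_normal_vec:
  assumes "\<mu> \<in> confocal_params a"
  shows "X \<bullet> k = (\<Sum>i\<in>UNIV. a $ i * normal_vec a \<mu> X $ i * k $ i) - \<mu> * (normal_vec a \<mu> X \<bullet> k)"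
proof -
  have "X $ i * k $ i =
      a $ i * normal_vec a \<mu> X $ i * k $ i - \<mu> * (normal_vec a \<mu> X $ i * k $ i)" for i
    by (subst normal_vec_inverse[OF assms]) (simp add: algebra_simps)
  then show ?thesis by (simp add: inner_vec_def sum_distrib_left sum_subtractf)
qed

text \<open>Both forms have the value 1 at \<open>X\<close>, so the numerator in
  \<open>confocal_form_normal_vec\<close> vanishes.\<close>

lemma normals_orthogonal:
  assumes "\<mu> \<in> confocal_params a" "\<nu> \<in> confocal_params a" "\<mu> \<noteq> \<nu>"
    and "X \<in> quadric a \<mu>" "X \<in> quadric a \<nu>"
  shows "normal_vec a \<mu> X \<bullet> normal_vec a \<nu> X = 0"
  using assms by (simp add: normal_vec_inner confocal_form_normal_vec quadric_iff)

text \<open>Only a coordinate axis is normal to several quadrics of the family or in several points to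
  one of them, and its discriminant has no zeros.\<close>

lemma normal_foot_unique:
  fixes a :: "real^'n"
  assumes inj: "inj (\<lambda>i. a $ i)" and \<mu>: "\<mu> \<in> confocal_params a" and \<nu>: "\<nu> \<in> confocal_params a"
    and \<alpha>: "\<alpha> \<in> confocal_params a" "line_disc a X v \<alpha> = 0" and v: "v \<noteq> 0"
    and X: "X \<in> quadric a \<mu>" and Y: "Y \<in> quadric a \<nu>" and XY: "X - Y = t *\<^sub>R v"
    and n: "normal_vec a \<mu> X = s *\<^sub>R v" and k: "normal_vec a \<nu> Y = r *\<^sub>R v"
  shows "\<mu> = \<nu> \<and> X = Y"
proof -
  have Xi: "X $ i = (a $ i - \<mu>) * (s * v $ i)" for i
    using normal_vec_inverse[OF \<mu>, of X i] n by simp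
  have Yi: "Y $ i = (a $ i - \<nu>) * (r * v $ i)" for i
    using normal_vec_inverse[OF \<nu>, of Y i] k by simp
  \<comment> \<open>If \<open>s\<close> and \<open>r\<close> differed, every coordinate with
    \<open>v $ j \<noteq> 0\<close> would yield the same value of \<open>a $ j\<close>. As these are
    distinct, \<open>v\<close> would lie along a single axis, whose discriminant
    \<open>v $ i * v $ i / (a $ i - \<alpha>)\<close> is not zero.\<close>
  have "s = r"
  proof (rule ccontr)
    assume sr: "s \<noteq> r"
    obtain i where i: "v $ i \<noteq> 0" using v by (auto simp: vec_eq_iff)
    have eq: "(s - r) * a $ j = t + s * \<mu> - r * \<nu>" if "v $ j \<noteq> 0" for j
    proof -
      have "(X - Y) $ j = t * v $ j" using XY by simp
      then have "((a $ j - \<mu>) * s - (a $ j - \<nu>) * r) * v $ j = t * v $ j"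
        by (simp add: Xi Yi algebra_simps)
      then have "(a $ j - \<mu>) * s - (a $ j - \<nu>) * r = t" using that by simp
      then show ?thesis by (simp add: algebra_simps)
    qed
    have z: "v $ j = 0" if "j \<noteq> i" for j
    proof (rule ccontr)
      assume "v $ j \<noteq> 0"
      then have "(s - r) * a $ j = (s - r) * a $ i" using eq i by simp
      then have "a $ j = a $ i" using sr by simp
      then show False using inj that by (auto dest: injD)
    qed
    have form: "confocal_form a \<alpha> x y = x $ i * y $ i / (a $ i - \<alpha>)"
      if "\<And>j. j \<noteq> i \<Longrightarrow> y $ j = 0" for x y
      unfolding confocal_form_def
      by (subst sum.remove[of _ i]) (auto simp: that intro!: sum.neutral)
    have zX: "X $ j = 0" if "j \<noteq> i" for j using z[OF that] Xi by simp
    have ai: "a $ i - \<alpha> \<noteq> 0" using \<alpha> by (metis (mono_tags) confocal_params_def eq_iff_diff_eq_0 mem_Collect_eq)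
    have fv: "confocal_form a \<alpha> x v = x $ i * v $ i / (a $ i - \<alpha>)" for x
      by (rule form) (rule z)
    have fX: "confocal_form a \<alpha> X X = X $ i * X $ i / (a $ i - \<alpha>)"
      by (rule form) (rule zX)
    have "line_disc a X v \<alpha> = v $ i * v $ i / (a $ i - \<alpha>)"
      unfolding line_disc_def fv fX
      by (simp add: divide_inverse algebra_simps power2_eq_square)
    then show False using \<alpha> i ai by simp
  qed
  then have nk: "normal_vec a \<mu> X = normal_vec a \<nu> Y" using n k by simp
  define m where "m = normal_vec a \<mu> X"
  have "X \<bullet> m = 1" "Y \<bullet> m = 1"
    using inner_own_normal_vec[OF X] inner_own_normal_vec[OF Y] nk by (simp_all add: m_def)
  moreover define S where "S = (\<Sum>i\<in>UNIV. a $ i * m $ i * m $ i)"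
  \<comment> \<open>Written in the common normal \<open>m\<close>, the two equations differ only in
    the parameter of the quadric.\<close>
  ultimately have "1 = S - \<mu> * (m \<bullet> m)" "1 = S - \<nu> * (m \<bullet> m)"
    using inner_normal_vec[OF \<mu>, of X m] inner_normal_vec[OF \<nu>, of Y m] nk
    by (simp_all add: m_def)
  then have "(\<mu> - \<nu>) * (m \<bullet> m) = 0" unfolding left_diff_distrib by linarith
  then have "\<mu> = \<nu>" using normal_vec_nonzero[OF X] by (simp add: m_def)
  then show ?thesis using nk normal_vec_inject \<mu> by blast
qed

section \<open>Double reflection configurations\<close>

text \<open>The hyperplane \<open>n \<bullet> y = 1\<close> is represented by the vector
  \<open>(n, 1)\<close>. Two distinct vectors of this kind form a basis of the pencil, and the last
  component forces the coefficients to add up to 1.\<close>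

lemma pencil_affine_combination:
  fixes n1 n2 k :: "'a::euclidean_space" and p q :: "'a \<times> real"
  assumes "(n1, 1) \<in> span {p, q}" "(n2, 1) \<in> span {p, q}" "(k, 1) \<in> span {p, q}" "n1 \<noteq> n2"
  obtains s where "k = (1 - s) *\<^sub>R n1 + s *\<^sub>R n2"
proof -
  let ?B = "{(n1, 1::real), (n2, 1)}"
  have ind: "independent ?B"
  proof (rule independent_insertI)
    show "(n1, 1::real) \<notin> span {(n2, 1)}"
      using assms(4) by (auto simp: span_singleton)
    show "independent {(n2, 1::real)}"
      by (simp add: dependent_single zero_prod_def)
  qed
  have "dim (span {p, q}) \<le> card {p, q}" unfolding dim_span by (rule dim_le_card') simp
  also have "\<dots> \<le> 2" by (simp add: card_insert_if)
  also have "2 = card ?B" using assms(4) by simp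
  finally have "span {p, q} \<subseteq> span ?B"
    using card_ge_dim_independent[of ?B "span {p, q}"] ind assms(1,2) by blast
  then have "(k, 1) \<in> span ?B" using assms by blast
  then obtain \<alpha> \<beta> where "(k, 1) - \<alpha> *\<^sub>R (n1, 1) = \<beta> *\<^sub>R (n2, 1::real)"
    by (auto simp: span_insert span_singleton)
  then have "k = \<alpha> *\<^sub>R n1 + \<beta> *\<^sub>R n2" "\<alpha> = 1 - \<beta>" by (auto simp: algebra_simps)
  then show ?thesis using that by blast
qed

text \<open>\<open>in_pencil\<close> admits arbitrary equations of the hyperplanes. Since the
  equation of a hyperplane is unique up to a factor, the normalized one with right side 1 also lies
  in the pencil.\<close>

lemma hyperplane_eq_imp:
  fixes w n :: "'a::euclidean_space"
  assumes eq: "{y. w \<bullet> y = c} = {y. n \<bullet> y = 1}" and w: "w \<noteq> 0" and n: "n \<noteq> 0"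
  shows "\<exists>r. (n, 1::real) = r *\<^sub>R (w, c)"
proof -
  define y0 where "y0 = (1 / (n \<bullet> n)) *\<^sub>R n"
  have y0: "n \<bullet> y0 = 1" using n by (simp add: y0_def)
  then have wy0: "w \<bullet> y0 = c" using eq by blast
  have "w \<bullet> (y0 + z) = c" if "n \<bullet> z = 0" for z
  proof -
    have "n \<bullet> (y0 + z) = 1" using y0 that by (simp add: inner_add_right)
    then show ?thesis using eq by blast
  qed
  then have perp: "w \<bullet> z = 0" if "n \<bullet> z = 0" for z
    using that wy0 by (simp add: inner_add_right)
  define u where "u = w - ((n \<bullet> w) / (n \<bullet> n)) *\<^sub>R n"
  have "n \<bullet> u = 0" using n by (simp add: u_def inner_diff_right)
  moreover from this have "w \<bullet> u = 0" by (rule perp)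
  ultimately have "u \<bullet> u = 0" by (simp add: u_def inner_diff_left)
  then have wn: "w = ((n \<bullet> w) / (n \<bullet> n)) *\<^sub>R n" by (simp add: u_def)
  then obtain r where r: "w = r *\<^sub>R n" by blast
  then have "c = r" "r \<noteq> 0" using wy0 y0 w by auto
  then have "(n, 1) = (1 / r) *\<^sub>R (w, c)" using r by simp
  then show ?thesis by blast
qed

lemma tangent_hyperplane_eq:
  "X \<in> quadric a \<mu> \<Longrightarrow> tangent_hyperplane a \<mu> X = {y. normal_vec a \<mu> X \<bullet> y = 1}"
  by (simp add: tangent_hyperplane_def inner_diff_right normal_vec_inner quadric_iff)

text \<open>The lines \<open>v\<close> and \<open>mirror k1 v\<close> are reflected on the first quadric in corresponding ones of their
  two points of intersection: the equation \<open>n2 \<bullet> mirror k1 v = - (n1 \<bullet> v)\<close> would hold for the other one.\<close>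

lemma pencil_reflection:
  fixes a :: "real^'n"
  assumes \<mu>: "\<mu> \<in> confocal_params a" and \<nu>: "\<nu> \<in> confocal_params a"
    and X1: "X1 \<in> quadric a \<mu>" and X2: "X2 \<in> quadric a \<mu>" and Y1: "Y1 \<in> quadric a \<nu>"
    and n1: "n1 = normal_vec a \<mu> X1" and n2: "n2 = normal_vec a \<mu> X2"
    and k1: "k1 = normal_vec a \<nu> Y1"
    and XY: "X1 - Y1 = t *\<^sub>R v" and k1s: "k1 = (1 - s) *\<^sub>R n1 + s *\<^sub>R n2"
    and X2Y1: "X2 - Y1 = r *\<^sub>R mirror k1 v" and ne: "X1 \<noteq> X2"
  shows "n2 \<bullet> mirror k1 v = n1 \<bullet> v"
proof -
  \<comment> \<open>\<open>B\<close> is the bilinear form of the diagonal matrix with entries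
    \<open>a $ i - \<mu>\<close>. It satisfies \<open>X1 \<bullet> m = B n1 m\<close>, which turns
    all hypotheses into equations between normals.\<close>
  define B where "B p q = (\<Sum>i\<in>UNIV. a $ i * p $ i * q $ i) - \<mu> * (p \<bullet> q)" for p q :: "real^'n"
  have B: "B (p + q) m = B p m + B q m" "B m (p + q) = B m p + B m q"
      "B (c *\<^sub>R p) m = c * B p m" "B m (c *\<^sub>R p) = c * B m p" for p q m c
    by (simp_all add: B_def sum.distrib inner_add algebra_simps sum_distrib_left)
  have sym: "B p q = B q p" for p q by (simp add: B_def inner_commute mult_ac)
  have X: "X1 \<bullet> m = B n1 m" "X2 \<bullet> m = B n2 m" for m
    unfolding B_def n1 n2 by (rule inner_normal_vec[OF \<mu>])+
  have Y: "Y1 \<bullet> m = B k1 m - (\<nu> - \<mu>) * (k1 \<bullet> m)" for m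
    using inner_normal_vec[OF \<nu>, of Y1 m] by (simp add: B_def k1 algebra_simps)
  have one: "X1 \<bullet> n1 = 1" "X2 \<bullet> n2 = 1" "Y1 \<bullet> k1 = 1"
    using X1 X2 Y1 by (simp_all add: n1 n2 k1 inner_own_normal_vec)
  have k0: "k1 \<noteq> 0" using normal_vec_nonzero[OF Y1] by (simp add: k1)
  define b1 c1 b' \<beta> \<delta> where "b1 = n1 \<bullet> v" and "c1 = k1 \<bullet> v" and "b' = n2 \<bullet> v"
    and "\<beta> = B n1 n2 - 1" and "\<delta> = \<nu> - \<mu>"
  have t: "(X1 - Y1) \<bullet> m = t * (m \<bullet> v)" for m using XY by (simp add: inner_commute)
  have c1: "c1 = (1 - s) * b1 + s * b'" by (simp add: c1_def b1_def b'_def k1s inner_add)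
  have Bn: "B n1 n1 = 1" "B n2 n2 = 1" using one X by simp_all
  have Bnk: "B n1 k1 = 1 + s * \<beta>" unfolding k1s B Bn \<beta>_def by (simp add: algebra_simps)
  have "B k1 k1 = 1 + 2 * s * (1 - s) * \<beta>"
    unfolding k1s B Bn sym[of n2 n1] \<beta>_def by (simp add: algebra_simps)
  then have kk: "\<delta> * (k1 \<bullet> k1) = 2 * s * (1 - s) * \<beta>"
    using one(3) by (simp add: Y \<delta>_def)
  have tc: "s * \<beta> = t * c1"
    using t[of k1] by (simp add: inner_diff_left X one Bnk c1_def)
  have tb: "\<delta> * (n1 \<bullet> k1) = t * (b1 + c1)"
    using t[of n1] tc
    by (simp add: inner_diff_left one(1) Y sym[of k1 n1] Bnk b1_def \<delta>_def inner_commute algebra_simps)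
  have m: "n2 \<bullet> mirror k1 v = b' - 2 * c1 * (n2 \<bullet> k1) / (k1 \<bullet> k1)"
    by (simp add: mirror_def b'_def c1_def inner_diff_right inner_commute)
  show ?thesis
  proof (cases "\<mu> = \<nu>")
    case False
    \<comment> \<open>On distinct quadrics \<open>kk\<close> shows that \<open>s\<close> is not
      zero, so both \<open>s\<close> and \<open>\<delta>\<close> can be cancelled in the products
      below.\<close>
    then have "\<delta> * (k1 \<bullet> k1) \<noteq> 0" using k0 by (simp add: \<delta>_def)
    then have s: "s \<noteq> 0" using kk by auto
    have kk': "\<delta> * (k1 \<bullet> k1) = 2 * (1 - s) * (t * c1)" using kk tc by algebra
    have "k1 \<bullet> k1 = (1 - s) * (n1 \<bullet> k1) + s * (n2 \<bullet> k1)"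
      using arg_cong[OF k1s, of "\<lambda>x. x \<bullet> k1"] by (simp add: inner_add_left)
    then have "s * (\<delta> * (n2 \<bullet> k1)) = \<delta> * (k1 \<bullet> k1) - (1 - s) * (\<delta> * (n1 \<bullet> k1))"
      by algebra
    also have "\<dots> = (1 - s) * t * (c1 - b1)" unfolding kk' tb by (simp add: algebra_simps)
    finally have nk: "s * (\<delta> * (n2 \<bullet> k1)) = (1 - s) * t * (c1 - b1)" .
    have sb: "s * (b' - b1) = c1 - b1" by (simp add: c1 algebra_simps)
    have "s * (\<delta> * (k1 \<bullet> k1) * (b' - b1)) = 2 * (1 - s) * (t * c1) * (c1 - b1)"
      unfolding kk' sb[symmetric] by (rule mult.left_commute)
    also have "\<dots> = s * (2 * c1 * (\<delta> * (n2 \<bullet> k1)))" using nk by algebra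
    finally have "\<delta> * (k1 \<bullet> k1) * (b' - b1) = 2 * c1 * (\<delta> * (n2 \<bullet> k1))"
      using s by simp
    then have "\<delta> * ((k1 \<bullet> k1) * (b' - b1)) = \<delta> * (2 * c1 * (n2 \<bullet> k1))"
      by (simp only: mult_ac)
    moreover have "\<delta> \<noteq> 0" using False by (simp add: \<delta>_def)
    ultimately have "(k1 \<bullet> k1) * (b' - b1) = 2 * c1 * (n2 \<bullet> k1)" by simp
    then have "b' - b1 = 2 * c1 * (n2 \<bullet> k1) / (k1 \<bullet> k1)" using k0 by (simp add: field_simps)
    then show ?thesis unfolding m by (simp add: b1_def)
  next
    case True
    have inj: "n1 = k1 \<Longrightarrow> X1 = Y1" "n2 = k1 \<Longrightarrow> X2 = Y1" "n1 \<noteq> n2"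
      using normal_vec_inject[OF \<mu>] True ne by (auto simp: n1 n2 k1)
    have \<delta>: "\<delta> = 0" using True by (simp add: \<delta>_def)
    have mk: "k1 \<bullet> mirror k1 v = - c1" using k0 by (simp add: mirror_inner c1_def)
    have r: "(X2 - Y1) \<bullet> m = r * (m \<bullet> mirror k1 v)" for m using X2Y1 by (simp add: inner_commute)
    have r': "r * (n2 \<bullet> mirror k1 v - c1) = 0"
    proof -
      have "r * (n2 \<bullet> mirror k1 v) = 1 - B n2 k1"
        using r[of n2] True by (simp add: inner_diff_left one Y sym[of k1 n2])
      moreover have "r * c1 = 1 - B n2 k1"
        using r[of k1] by (simp add: inner_diff_left one X mk)
      ultimately show ?thesis by algebra
    qed
    \<comment> \<open>For \<open>\<delta> = 0\<close> the equations \<open>kk\<close> and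
      \<open>tc\<close> read \<open>s * (1 - s) * \<beta> = 0\<close> and
      \<open>s * \<beta> = t * c1\<close>. Only coinciding points and a line tangent at
      \<open>Y1\<close> remain.\<close>
    have "s = 0 \<or> s = 1 \<or> (\<beta> = 0 \<and> t = 0) \<or> (\<beta> = 0 \<and> c1 = 0 \<and> t \<noteq> 0)"
      using kk tc \<delta> by auto
    then consider "X1 = Y1" | "X2 = Y1" "X1 \<noteq> Y1" | "c1 = 0" "t \<noteq> 0"
      using inj k1s XY by fastforce
    then show ?thesis
    proof cases
      case 1
      then have "n1 = k1" "X2 \<noteq> Y1" using True ne by (auto simp: n1 k1)
      then show ?thesis using r' X2Y1 by (auto simp: c1_def)
    next
      case 2
      then have "n2 = k1" "t \<noteq> 0" using True XY by (auto simp: n2 k1)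
      then show ?thesis using tb \<delta> mk by (simp add: b1_def)
    next
      case 3
      then have b1: "b1 = 0" using tb \<delta> by simp
      have "n2 \<bullet> mirror k1 v = 0"
      proof (cases "r = 0")
        case True
        then have "n2 = k1" using X2Y1 \<open>\<mu> = \<nu>\<close> by (simp add: n2 k1)
        then show ?thesis using mk 3 by simp
      next
        case False
        then show ?thesis using r' 3 by simp
      qed
      then show ?thesis using b1 by (simp add: b1_def)
    qed
  qed
qed

section \<open>Mirror images of directions and configurations with coinciding points\<close>

lemma mirror_uminus: "mirror n (- v) = - mirror n v"
  by (simp add: mirror_def algebra_simps)

lemma mirror_mirror: "n \<noteq> 0 \<Longrightarrow> mirror n (mirror n v) = v"
  using mirror_inner[of n v] by (simp add: mirror_def inner_commute)

lemma norm_mirror: "n \<noteq> 0 \<Longrightarrow> norm (mirror n v) = norm v"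
proof -
  assume n: "n \<noteq> 0"
  have "mirror n v \<bullet> mirror n v = v \<bullet> mirror n v - 2 * (v \<bullet> n) / (n \<bullet> n) * (n \<bullet> mirror n v)"
    by (subst (1) mirror_def) (simp add: inner_diff_left)
  also have "\<dots> = v \<bullet> v"
    using n by (simp add: mirror_inner) (simp add: mirror_def inner_diff_right inner_commute)
  finally show ?thesis by (simp add: norm_eq_sqrt_inner)
qed

lemma mirror_eq_uminus:
  assumes "mirror n v = - v" "v \<noteq> 0"
  obtains r where "n = r *\<^sub>R v"
proof -
  define c where "c = 2 * (v \<bullet> n) / (n \<bullet> n)"
  have "v - c *\<^sub>R n = - v" using assms(1) by (simp add: mirror_def c_def)
  then have "c *\<^sub>R n = 2 *\<^sub>R v" by (simp add: algebra_simps scaleR_2)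
  moreover from this have "c \<noteq> 0" using assms(2) by auto
  moreover from this have "n = (1 / c) *\<^sub>R c *\<^sub>R n" by simp
  ultimately have "n = (2 / c) *\<^sub>R v" by simp
  then show ?thesis using that by blast
qed

lemma unit_directions_through_two_points:
  fixes v w :: "'a::real_normed_vector"
  assumes "z = t *\<^sub>R v" "z = r *\<^sub>R w" "z \<noteq> 0" "norm v = 1" "norm w = 1"
  shows "w = v \<or> w = - v"
proof -
  have "\<bar>t\<bar> = \<bar>r\<bar>" using assms by (metis mult.right_neutral norm_scaleR)
  then have "t = r \<or> t = - r" by (auto simp: abs_if split: if_splits)
  moreover have "r \<noteq> 0" using assms by auto
  moreover have "r *\<^sub>R w = t *\<^sub>R v" using assms by simp
  ultimately show ?thesis
    by (metis scaleR_left_imp_eq scaleR_minus_left scaleR_minus_right)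
qed

text \<open>For distinct \<open>X1\<close> and \<open>X2\<close> this is
  \<open>pencil_reflection\<close>. If they coincide, only the sign is in doubt. With the wrong
  sign, reflection at any \<open>Y1\<close> or \<open>Y2\<close> other than \<open>X1\<close> would
  reverse a line, making it normal there, and each arrangement of the points would give that line a
  second normal foot at \<open>X1\<close>, against \<open>normal_foot_unique\<close>.\<close>

lemma pencil_same_intersection:
  fixes a :: "real^'n"
  assumes inj: "inj (\<lambda>i. a $ i)" and \<mu>: "\<mu> \<in> confocal_params a" and \<nu>: "\<nu> \<in> confocal_params a"
    and \<alpha>: "\<alpha> \<in> confocal_params a" "line_disc a X1 v11 \<alpha> = 0" and v11: "norm v11 = 1"
    and X1: "X1 \<in> quadric a \<mu>" and X2: "X2 \<in> quadric a \<mu>"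
    and Y1: "Y1 \<in> quadric a \<nu>" and Y2: "Y2 \<in> quadric a \<nu>"
    and n1: "n1 = normal_vec a \<mu> X1" and n2: "n2 = normal_vec a \<mu> X2"
    and k1: "k1 = normal_vec a \<nu> Y1" and k2: "k2 = normal_vec a \<nu> Y2"
    and v12: "v12 = mirror n1 v11" and v21: "v21 = mirror k1 v11"
    and v22: "v22 = mirror n2 v21" "v22 = mirror k2 v12"
    and t: "X1 - Y1 = t11 *\<^sub>R v11" "X1 - Y2 = t12 *\<^sub>R v12"
      "X2 - Y1 = t21 *\<^sub>R v21" "X2 - Y2 = t22 *\<^sub>R v22"
    and pencil: "{(n1, 1), (n2, 1), (k1, 1), (k2, 1)} \<subseteq> span {p, q :: (real^'n) \<times> real}"
    and ne: "\<not> (n2 = n1 \<and> k1 = n1 \<and> k2 = n1)"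
  shows "n2 \<bullet> v21 = n1 \<bullet> v11"
proof (cases "X1 = X2")
  case False
  then have "n1 \<noteq> n2" using normal_vec_inject[OF \<mu>] by (auto simp: n1 n2)
  then obtain s where s: "k1 = (1 - s) *\<^sub>R n1 + s *\<^sub>R n2"
    using pencil_affine_combination[of n1 p q n2 k1] pencil by auto
  show ?thesis
    unfolding v21
    by (rule pencil_reflection[OF \<mu> \<nu> X1 X2 Y1 n1 n2 k1 t(1) s t(3)[unfolded v21] False])
next
  case True
  have nz: "n1 \<noteq> 0" "k1 \<noteq> 0" "k2 \<noteq> 0"
    using normal_vec_nonzero X1 Y1 Y2 by (auto simp: n1 k1 k2)
  have n2n1: "n2 = n1" using True by (simp add: n1 n2)
  have unit: "norm v12 = 1" "norm v21 = 1" "norm v22 = 1"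
    using v11 nz n2n1 by (simp_all add: v12 v21 v22(1) norm_mirror)
  have v0: "v11 \<noteq> 0" "v12 \<noteq> 0" using v11 unit by auto
  have shift: "line_disc a X1 w \<kappa> = line_disc a Y w \<kappa>" if "X1 - Y = r *\<^sub>R w" for Y r w \<kappa>
    using line_disc_shift[of a Y r w \<kappa>] that by (metis diff_eq_eq add.commute)
  have disc12: "line_disc a X1 v12 \<alpha> = 0"
    using line_disc_mirror[OF \<alpha>(1) \<mu> X1] \<alpha>(2) by (simp add: v12 n1)
  \<comment> \<open>Both lines pass through the common point \<open>X1\<close>, so invariance of the
    discriminant under the reflection at \<open>Y1\<close> determines the product up to its
    sign.\<close>
  have "line_disc a X1 v21 \<mu> = line_disc a X1 v11 \<mu>"
    using shift[of Y1 t21 v21 \<mu>] shift[OF t(1), of \<mu>] t(3) True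
      line_disc_mirror[OF \<mu> \<nu> Y1, of v11] by (simp add: v21 k1)
  then have sq: "(n1 \<bullet> v21)\<^sup>2 = (n1 \<bullet> v11)\<^sup>2" by (simp add: line_disc_at[OF X1] n1)
  show ?thesis
  proof (rule ccontr)
    assume neq: "n2 \<bullet> v21 \<noteq> n1 \<bullet> v11"
    then have "n1 \<bullet> v21 = - (n1 \<bullet> v11)" using sq n2n1 power2_eq_iff by blast
    then have b: "n1 \<bullet> v11 \<noteq> 0" "n1 \<bullet> v21 = - (n1 \<bullet> v11)" using neq n2n1 by auto
    have v22': "v22 = mirror n1 v21" using v22(1) n2n1 by simp
    have ne11: "v12 \<noteq> v11" using b(1) nz(1) mirror_inner[of n1 v11] by (auto simp: v12)
    have opp1: "v21 = - v11" if "X1 \<noteq> Y1"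
    proof -
      have "v21 = v11 \<or> v21 = - v11"
        by (rule unit_directions_through_two_points[OF t(1) t(3)[folded True]])
          (use that v11 unit in auto)
      then show ?thesis using neq n2n1 by auto
    qed
    have opp2: "v22 = - v12" if "X1 \<noteq> Y2"
    proof -
      have "v22 = v12 \<or> v22 = - v12"
        by (rule unit_directions_through_two_points[OF t(2) t(4)[folded True]])
          (use that unit in auto)
      moreover have "v22 \<noteq> v12"
      proof
        assume "v22 = v12"
        then have "v21 = v11" using mirror_mirror nz(1) v22' v12 by metis
        then show False using neq n2n1 by simp
      qed
      ultimately show ?thesis by blast
    qed
    have par1: "\<exists>r. k1 = r *\<^sub>R v11" if "X1 \<noteq> Y1"
      using opp1[OF that] mirror_eq_uminus[of k1 v11] v0 unfolding v21 by metis
    have par2: "\<exists>r. k2 = r *\<^sub>R v12" if "X1 \<noteq> Y2"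
      using opp2[OF that] mirror_eq_uminus[of k2 v12] v0 unfolding v22(2) by metis
    have foot1: "n1 \<noteq> s *\<^sub>R v11" if "X1 \<noteq> Y1" for s
      using par1[OF that] normal_foot_unique[OF inj \<mu> \<nu> \<alpha> v0(1) X1 Y1 t(1), of s] that
      by (auto simp: n1 k1)
    have foot2: "n1 \<noteq> s *\<^sub>R v12" if "X1 \<noteq> Y2" for s
      using par2[OF that] normal_foot_unique[OF inj \<mu> \<nu> \<alpha>(1) disc12 v0(2) X1 Y2 t(2), of s] that
      by (auto simp: n1 k2)
    consider "X1 \<noteq> Y1" "X1 \<noteq> Y2" | "X1 = Y1" | "X1 \<noteq> Y1" "X1 = Y2" by blast
    then show False
    proof cases
      case 1
      have "Y1 \<noteq> Y2"
      proof
        assume "Y1 = Y2"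
        then have "X1 - Y1 = t12 *\<^sub>R v12" using t(2) by simp
        from unit_directions_through_two_points[OF t(1) this _ v11 unit(1)]
        have "v12 = v11 \<or> v12 = - v11" using 1 by simp
        then obtain r where "n1 = r *\<^sub>R v11"
          using mirror_eq_uminus[of n1 v11] v0 ne11 v12 by metis
        then show False using foot1 1 by blast
      qed
      then have "k1 \<noteq> k2" using normal_vec_inject[OF \<nu>] by (auto simp: k1 k2)
      then obtain s where s: "n1 = (1 - s) *\<^sub>R k1 + s *\<^sub>R k2"
        using pencil_affine_combination[of k1 p q k2 n1] pencil by auto
      define c where "c = k1 \<bullet> v11"
      \<comment> \<open>\<open>pencil_reflection\<close> is now applied with the quadrics exchanged:
        \<open>Y1\<close> and \<open>Y2\<close> are the two points on one quadric and
        \<open>X1\<close> is the point on the other.\<close>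
      have "Y1 - X1 = (- t11) *\<^sub>R v11" "Y2 - X1 = (- t12) *\<^sub>R mirror n1 v11"
        using t by (simp_all add: v12[symmetric] algebra_simps)
      from pencil_reflection[OF \<nu> \<mu> Y1 Y2 X1 k1 k2 n1 this(1) s this(2) \<open>Y1 \<noteq> Y2\<close>]
      have c2: "c = k2 \<bullet> v12" by (simp add: c_def v12)
      have k: "k1 = c *\<^sub>R v11" "k2 = c *\<^sub>R v12"
        using par1[OF 1(1)] par2[OF 1(2)] v11 unit(1) c2
        by (auto simp: c_def norm_eq_1)
      have c0: "c \<noteq> 0" using k nz by auto
      define \<beta> where "\<beta> = 2 * (v11 \<bullet> n1) / (n1 \<bullet> n1)"
      have "v12 = v11 - \<beta> *\<^sub>R n1" by (simp add: v12 mirror_def \<beta>_def)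
      then have "n1 = ((1 - s) * c) *\<^sub>R v11 + (s * c) *\<^sub>R (v11 - \<beta> *\<^sub>R n1)"
        using s k by simp
      then have e: "(1 + s * c * \<beta>) *\<^sub>R n1 = c *\<^sub>R v11" by (simp add: algebra_simps)
      then have "1 + s * c * \<beta> \<noteq> 0" using c0 v0 by auto
      then have "n1 = (1 / (1 + s * c * \<beta>)) *\<^sub>R (1 + s * c * \<beta>) *\<^sub>R n1" by simp
      then have "n1 = (c / (1 + s * c * \<beta>)) *\<^sub>R v11" unfolding e by simp
      then show False using foot1 1 by blast
    next
      case 2
      have \<mu>\<nu>: "\<mu> = \<nu>"
      proof (rule ccontr)
        assume "\<mu> \<noteq> \<nu>"
        then have "n1 \<bullet> k1 = 0" using normals_orthogonal[OF \<mu> \<nu> _ X1] Y1 2 by (simp add: n1 k1)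
        then show False using neq n2n1 by (simp add: v21 mirror_def inner_diff_right)
      qed
      then have k1n: "k1 = n1" using 2 by (simp add: n1 k1)
      \<comment> \<open>Three of the tangent hyperplanes coincide here; \<open>ne\<close> keeps the
        fourth one apart.\<close>
      then have "k2 \<noteq> n1" using ne n2n1 by simp
      then have Y2: "X1 \<noteq> Y2" using \<mu>\<nu> by (auto simp: n1 k2)
      have "v22 = v11" using nz by (simp add: v22' v21 k1n mirror_mirror)
      then have "v12 = - v11" using opp2[OF Y2] by (metis minus_minus)
      then obtain r where "n1 = r *\<^sub>R v11" using mirror_eq_uminus[of n1 v11] v0 v12 by metis
      then have "n1 = (- r) *\<^sub>R v12" using \<open>v12 = - v11\<close> by simp
      then show False using foot2 Y2 by blast
    next
      case 3
      have \<mu>\<nu>: "\<mu> = \<nu>"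
      proof (rule ccontr)
        assume "\<mu> \<noteq> \<nu>"
        then have "n1 \<bullet> k2 = 0" using normals_orthogonal[OF \<mu> \<nu> _ X1] Y2 3 by (simp add: n1 k2)
        then have "n1 \<bullet> v22 = n1 \<bullet> v12" by (simp add: v22(2) mirror_def inner_diff_right)
        then show False using b nz by (simp add: v22' v12 mirror_inner)
      qed
      then have k2n: "k2 = n1" using 3 by (simp add: n1 k2)
      have "v22 = v11" using nz by (simp add: v22(2) v12 k2n mirror_mirror)
      moreover have "v22 = - v12" using opp1 3 by (simp add: v22' v12 mirror_uminus)
      ultimately have "v12 = - v11" by (metis minus_minus)
      then obtain r where "n1 = r *\<^sub>R v11" using mirror_eq_uminus[of n1 v11] v0 v12 by metis
      then show False using foot1 3 by blast
    qed
  qed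
qed

section \<open>Directed lines and their points on the spectral curve\<close>

lemma dreflection_lawD:
  assumes "dreflection_law a \<mu> P l m"
  shows "is_dline l" "is_dline m" "P \<in> quadric a \<mu>" "P \<in> fst l" "P \<in> fst m"
    "snd m = mirror (normal_vec a \<mu> P) (snd l)"
  using assms by (auto simp: dreflection_law_def reflection_law_def)

lemma dline_norm: "is_dline l \<Longrightarrow> norm (snd l) = 1"
  by (simp add: is_dline_def unit_direction_def)

lemma dline_eq: "is_dline l \<Longrightarrow> P \<in> fst l \<Longrightarrow> fst l = range (\<lambda>t. P + t *\<^sub>R snd l)"
  unfolding is_dline_def by (rule line_eq) auto

lemma dline_diff:
  assumes "is_dline l" "P \<in> fst l" "Q \<in> fst l"
  obtains t where "P - Q = t *\<^sub>R snd l"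
proof -
  obtain t where "P = Q + t *\<^sub>R snd l" using dline_eq[OF assms(1,3)] assms(2) by auto
  then show ?thesis using that[of t] by simp
qed

lemma line_disc_dline:
  assumes "is_dline l" "P \<in> fst l" "Q \<in> fst l"
  shows "line_disc a P (snd l) = line_disc a Q (snd l)"
proof -
  obtain t where "P - Q = t *\<^sub>R snd l" using dline_diff assms .
  then have "P = Q + t *\<^sub>R snd l" by (simp add: diff_eq_eq)
  then show ?thesis by (simp add: line_disc_shift fun_eq_iff)
qed

text \<open>A weakening of tangency that also admits contact at infinity. It is what
  \<open>normal_foot_unique\<close> needs, and it passes to every reflected line, including the
  lines that complete configurations, which are not assumed to be tangent to anything.\<close>

definition touching :: "real^'n \<Rightarrow> 'n dline \<Rightarrow> bool" where
  "touching a l \<longleftrightarrow> is_dline l \<and>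
     (\<exists>\<alpha>\<in>confocal_params a. \<forall>P\<in>fst l. line_disc a P (snd l) \<alpha> = 0)"

lemma touching_dreflection:
  assumes "touching a l" "\<mu> \<in> confocal_params a" "dreflection_law a \<mu> P l m"
  shows "touching a m"
proof -
  note r = dreflection_lawD[OF assms(3)]
  obtain \<alpha> where \<alpha>: "\<alpha> \<in> confocal_params a" "line_disc a P (snd l) \<alpha> = 0"
    using assms(1) r(4) by (auto simp: touching_def)
  then have "line_disc a P (snd m) \<alpha> = 0"
    using line_disc_mirror[OF \<alpha>(1) assms(2) r(3)] r(6) by simp
  then show ?thesis
    unfolding touching_def using r(2,5) \<alpha>(1) line_disc_dline[OF r(2) _ r(5)] by metis
qed

lemma tangent_line_disc:
  assumes "is_dline l" "\<alpha> \<in> confocal_params a" "tangent_to_quadric a \<alpha> (fst l)" "P \<in> fst l"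
  shows "line_disc a P (snd l) \<alpha> = 0"
proof -
  obtain x where x: "x \<in> fst l" "x \<in> quadric a \<alpha>" "fst l \<subseteq> tangent_hyperplane a \<alpha> x"
    using assms(3) by (auto simp: tangent_to_quadric_def)
  have "x + snd l \<in> fst l" using assms(1) x(1) by (auto simp: is_dline_def unit_direction_def)
  then have "normal_vec a \<alpha> x \<bullet> snd l = 0" using x(3) by (auto simp: tangent_hyperplane_def)
  then show ?thesis
    using line_disc_dline[OF assms(1,4) x(1)] line_disc_at[OF x(2)] by simp
qed

text \<open>The quadric of a reflection together with the sign of \<open>normal_vec a \<mu> P \<bullet> snd l\<close> is a point of the
  spectral curve \<open>y\<^sup>2 = line_disc a P (snd l) \<mu>\<close>. The function \<open>e\<close> is the divisor of this point minus
  its conjugate.\<close>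

definition reflects :: "real^'n \<Rightarrow> 'n dline \<Rightarrow> 'n dline \<Rightarrow> (real \<Rightarrow> real) \<Rightarrow> bool" where
  "reflects a l m e \<longleftrightarrow> (\<exists>\<mu>\<in>confocal_params a. \<exists>P. dreflection_law a \<mu> P l m \<and>
     e = (\<lambda>\<kappa>. if \<kappa> = \<mu> then sgn (normal_vec a \<mu> P \<bullet> snd l) else 0))"

lemma mirror_fixed_iff: "n \<noteq> 0 \<Longrightarrow> mirror n v = v \<longleftrightarrow> n \<bullet> v = 0"
  by (auto simp: mirror_def inner_commute)

text \<open>If the direction is unchanged, the line is tangent and both divisors are zero. Otherwise
  two quadrics at one point are excluded by the orthogonality of their normals. Two different points
  would force a reversed direction, hence a line normal at both of them, against
  \<open>normal_foot_unique\<close>.\<close>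

lemma reflects_unique:
  fixes a :: "real^'n"
  assumes inj: "inj (\<lambda>i. a $ i)" and l: "touching a l" and e: "reflects a l m e" "reflects a l m e'"
  shows "e = e'"
proof -
  obtain \<mu> P where \<mu>: "\<mu> \<in> confocal_params a" and P: "dreflection_law a \<mu> P l m"
    and e1: "e = (\<lambda>\<kappa>. if \<kappa> = \<mu> then sgn (normal_vec a \<mu> P \<bullet> snd l) else 0)"
    using e(1) unfolding reflects_def by blast
  obtain \<nu> Q where \<nu>: "\<nu> \<in> confocal_params a" and Q: "dreflection_law a \<nu> Q l m"
    and e2: "e' = (\<lambda>\<kappa>. if \<kappa> = \<nu> then sgn (normal_vec a \<nu> Q \<bullet> snd l) else 0)"
    using e(2) unfolding reflects_def by blast
  note p = dreflection_lawD[OF P] and q = dreflection_lawD[OF Q]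
  define n k v where "n = normal_vec a \<mu> P" and "k = normal_vec a \<nu> Q" and "v = snd l"
  have nz: "n \<noteq> 0" "k \<noteq> 0" using normal_vec_nonzero p(3) q(3) by (auto simp: n_def k_def)
  have v: "norm v = 1" "norm (snd m) = 1" using dline_norm[OF p(1)] dline_norm[OF p(2)] by (simp_all add: v_def)
  then have v0: "v \<noteq> 0" by auto
  have m: "snd m = mirror n v" "snd m = mirror k v" using p(6) q(6) by (auto simp: n_def k_def v_def)
  show ?thesis
  proof (cases "snd m = v")
    case True
    then have "n \<bullet> v = 0" "k \<bullet> v = 0" using m nz mirror_fixed_iff by metis+
    then show ?thesis by (simp add: e1 e2 n_def k_def v_def fun_eq_iff)
  next
    case False
    have "\<mu> = \<nu> \<and> P = Q"
    proof (cases "P = Q")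
      case True
      have "\<mu> = \<nu>"
      proof (rule ccontr)
        assume "\<mu> \<noteq> \<nu>"
        then have nk: "n \<bullet> k = 0"
          using normals_orthogonal[OF \<mu> \<nu> _ p(3)] q(3) True by (simp add: n_def k_def)
        then have "n \<bullet> mirror k v = n \<bullet> v" by (simp add: mirror_def inner_diff_right)
        then have "n \<bullet> v = 0" using m mirror_inner[OF nz(1), of v] by simp
        then show False using m nz False mirror_fixed_iff by metis
      qed
      then show ?thesis using True by simp
    next
      case PQ: False
      obtain t where t: "P - Q = t *\<^sub>R v" using dline_diff[OF p(1,4) q(4)] v_def by metis
      obtain r where r: "P - Q = r *\<^sub>R snd m" using dline_diff[OF p(2,5) q(5)] by metis
      have "snd m = v \<or> snd m = - v"
        using unit_directions_through_two_points[OF t r _ v] PQ by simp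
      then have "snd m = - v" using False by simp
      then obtain s s' where "n = s *\<^sub>R v" "k = s' *\<^sub>R v" using mirror_eq_uminus v0 m by metis
      moreover obtain \<alpha> where "\<alpha> \<in> confocal_params a" "line_disc a P v \<alpha> = 0"
        using l p(4) by (auto simp: touching_def v_def)
      ultimately show ?thesis
        using normal_foot_unique[OF inj \<mu> \<nu> _ _ v0 p(3) q(3) t]
        unfolding n_def[symmetric] k_def[symmetric] by blast
    qed
    then have "\<mu> = \<nu>" "P = Q" by auto
    then show ?thesis unfolding e1 e2 by (simp only:)
  qed
qed

text \<open>This is the meaning of the pencil condition on the spectral curve: opposite reflections
  have equal products of normal and direction, hence equal signs over the same parameter.\<close>

lemma drc_reflects:
  fixes a :: "real^'n"
  assumes inj: "inj (\<lambda>i. a $ i)" and l11: "touching a l11" and drc: "drc a l11 l12 l21 l22"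
  obtains e where "reflects a l11 l21 e" "reflects a l12 l22 e" "touching a l12" "touching a l21" "touching a l22"
proof -
  obtain \<mu> \<nu> X1 X2 Y1 Y2 where \<mu>: "\<mu> \<in> confocal_params a" and \<nu>: "\<nu> \<in> confocal_params a"
    and X: "dreflection_law a \<mu> X1 l11 l12" "dreflection_law a \<mu> X2 l21 l22"
    and Y: "dreflection_law a \<nu> Y1 l11 l21" "dreflection_law a \<nu> Y2 l12 l22"
    and pencil: "in_pencil {tangent_hyperplane a \<mu> X1, tangent_hyperplane a \<mu> X2,
                   tangent_hyperplane a \<nu> Y1, tangent_hyperplane a \<nu> Y2}"
    and card: "card {tangent_hyperplane a \<mu> X1, tangent_hyperplane a \<mu> X2,
                   tangent_hyperplane a \<nu> Y1, tangent_hyperplane a \<nu> Y2} \<ge> 2"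
    using drc unfolding drc_def Let_def by blast
  note x1 = dreflection_lawD[OF X(1)] and x2 = dreflection_lawD[OF X(2)]
    and y1 = dreflection_lawD[OF Y(1)] and y2 = dreflection_lawD[OF Y(2)]
  define n1 n2 k1 k2 where "n1 = normal_vec a \<mu> X1" and "n2 = normal_vec a \<mu> X2"
    and "k1 = normal_vec a \<nu> Y1" and "k2 = normal_vec a \<nu> Y2"
  note nd = n1_def n2_def k1_def k2_def
  have H: "tangent_hyperplane a \<mu> X1 = {y. n1 \<bullet> y = 1}" "tangent_hyperplane a \<mu> X2 = {y. n2 \<bullet> y = 1}"
    "tangent_hyperplane a \<nu> Y1 = {y. k1 \<bullet> y = 1}" "tangent_hyperplane a \<nu> Y2 = {y. k2 \<bullet> y = 1}"
    using tangent_hyperplane_eq x1(3) x2(3) y1(3) y2(3) by (simp_all add: nd)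
  define Hs where "Hs = {{y. n1 \<bullet> y = 1}, {y. n2 \<bullet> y = 1}, {y. k1 \<bullet> y = 1}, {y. k2 \<bullet> y = 1}}"
  have nz: "n1 \<noteq> 0" "n2 \<noteq> 0" "k1 \<noteq> 0" "k2 \<noteq> 0"
    using normal_vec_nonzero x1(3) x2(3) y1(3) y2(3) by (simp_all add: nd)
  have "in_pencil Hs" using pencil unfolding H Hs_def .
  then obtain p q where pq: "\<forall>H\<in>Hs. \<exists>w c. w \<noteq> 0 \<and> H = {y. w \<bullet> y = c} \<and>
      (w, c) \<in> span {p, q :: (real^'n) \<times> real}"
    unfolding in_pencil_def by (elim exE)
  \<comment> \<open>Each of the four tangent hyperplanes has its normalized equation in the
    pencil.\<close>
  have sp: "(n, 1) \<in> span {p, q}" if n: "{y. n \<bullet> y = 1} \<in> Hs" "n \<noteq> 0" for n :: "real^'n"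
  proof -
    obtain w c where w: "w \<noteq> 0" "{y. n \<bullet> y = 1} = {y. w \<bullet> y = c}" "(w, c) \<in> span {p, q}"
      using bspec[OF pq n(1)] by (elim exE conjE)
    obtain r where "(n, 1::real) = r *\<^sub>R (w, c)"
      using hyperplane_eq_imp[OF w(2)[symmetric] w(1) n(2)] by (elim exE)
    then show ?thesis using span_scale[OF w(3), of r] by simp
  qed
  have pen: "{(n1, 1), (n2, 1), (k1, 1), (k2, 1)} \<subseteq> span {p, q}"
    using sp nz by (auto simp: Hs_def)
  have ne: "\<not> (k2 = k1 \<and> n1 = k1 \<and> n2 = k1)"
    using card unfolding H by auto
  obtain \<alpha> where \<alpha>: "\<alpha> \<in> confocal_params a" "line_disc a Y1 (snd l11) \<alpha> = 0"
    using l11 y1(4) by (auto simp: touching_def)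
  obtain t11 where t11: "Y1 - X1 = t11 *\<^sub>R snd l11" using dline_diff[OF y1(1,4) x1(4)] .
  obtain t12 where t12: "Y2 - X1 = t12 *\<^sub>R snd l12" using dline_diff[OF y2(1,4) x1(5)] .
  obtain t21 where t21: "Y1 - X2 = t21 *\<^sub>R snd l21" using dline_diff[OF y1(2,5) x2(4)] .
  obtain t22 where t22: "Y2 - X2 = t22 *\<^sub>R snd l22" using dline_diff[OF y2(2,5) x2(5)] .
  \<comment> \<open>The quadrics are exchanged because the reflections at \<open>Y1\<close> and
    \<open>Y2\<close> are to be compared.\<close>
  have "k2 \<bullet> snd l12 = k1 \<bullet> snd l11"
  proof (rule pencil_same_intersection[OF inj \<nu> \<mu> \<alpha> dline_norm[OF x1(1)] y1(3) y2(3) x1(3) x2(3)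
        k1_def k2_def n1_def n2_def y1(6)[folded k1_def] x1(6)[folded n1_def]
        y2(6)[folded k2_def] x2(6)[folded n2_def] t11 t21 t12 t22 _ ne])
    show "{(k1, 1), (k2, 1), (n1, 1), (n2, 1)} \<subseteq> span {p, q}" using pen by auto
  qed
  then have "reflects a l12 l22 (\<lambda>\<kappa>. if \<kappa> = \<nu> then sgn (k1 \<bullet> snd l11) else 0)"
    unfolding reflects_def k1_def k2_def using \<nu> Y(2) by force
  moreover have "reflects a l11 l21 (\<lambda>\<kappa>. if \<kappa> = \<nu> then sgn (k1 \<bullet> snd l11) else 0)"
    unfolding reflects_def k1_def using \<nu> Y(1) by blast
  ultimately show ?thesis
    using that touching_dreflection l11 X Y \<mu> \<nu> by metis
qed

section \<open>Rational functions with poles in the parameter set\<close>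

text \<open>The list \<open>rs\<close> records poles with multiplicity. Values at the poles are left
  free, while the formula holds at every \<open>a $ i\<close>, where the matrices act on the
  coordinates of a line.\<close>

definition confocal_rational :: "real^'n \<Rightarrow> (real \<Rightarrow> real) \<Rightarrow> bool" where
  "confocal_rational a f \<longleftrightarrow> (\<exists>p rs. set rs \<subseteq> confocal_params a \<and>
     (\<forall>\<kappa>. \<kappa> \<notin> set rs \<longrightarrow> f \<kappa> = poly p \<kappa> / (\<Prod>r\<leftarrow>rs. \<kappa> - r)))"

lemma prod_list_diff_eq_0_iff: "(\<Prod>r\<leftarrow>rs. \<kappa> - r) = 0 \<longleftrightarrow> (\<kappa> :: real) \<in> set rs"
  by (induction rs) auto

lemma confocal_rational_const: "confocal_rational a (\<lambda>_. c)"
  unfolding confocal_rational_def by (rule exI[of _ "[:c:]"], rule exI[of _ "[]"]) simp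

lemma confocal_rational_inverse:
  "\<mu> \<in> confocal_params a \<Longrightarrow> confocal_rational a (\<lambda>\<kappa>. c / (\<kappa> - \<mu>))"
  unfolding confocal_rational_def by (rule exI[of _ "[:c:]"], rule exI[of _ "[\<mu>]"]) simp

lemma confocal_rational_mult:
  assumes "confocal_rational a f" "confocal_rational a g"
  shows "confocal_rational a (\<lambda>\<kappa>. f \<kappa> * g \<kappa>)"
proof -
  obtain p rs q ss where "set rs \<subseteq> confocal_params a" "set ss \<subseteq> confocal_params a"
    and "\<And>\<kappa>. \<kappa> \<notin> set rs \<Longrightarrow> f \<kappa> = poly p \<kappa> / (\<Prod>r\<leftarrow>rs. \<kappa> - r)"
    and "\<And>\<kappa>. \<kappa> \<notin> set ss \<Longrightarrow> g \<kappa> = poly q \<kappa> / (\<Prod>r\<leftarrow>ss. \<kappa> - r)"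
    using assms unfolding confocal_rational_def by blast
  then show ?thesis
    unfolding confocal_rational_def by (intro exI[of _ "p * q"] exI[of _ "rs @ ss"]) simp
qed

lemma confocal_rational_add:
  assumes "confocal_rational a f" "confocal_rational a g"
  shows "confocal_rational a (\<lambda>\<kappa>. f \<kappa> + g \<kappa>)"
proof -
  obtain p rs q ss where *: "set rs \<subseteq> confocal_params a" "set ss \<subseteq> confocal_params a"
    and f: "\<And>\<kappa>. \<kappa> \<notin> set rs \<Longrightarrow> f \<kappa> = poly p \<kappa> / (\<Prod>r\<leftarrow>rs. \<kappa> - r)"
    and g: "\<And>\<kappa>. \<kappa> \<notin> set ss \<Longrightarrow> g \<kappa> = poly q \<kappa> / (\<Prod>r\<leftarrow>ss. \<kappa> - r)"
    using assms unfolding confocal_rational_def by blast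
  define P where "P rs = (\<Prod>r\<leftarrow>rs. [:- r, 1:])" for rs :: "real list"
  have P: "poly (P rs) \<kappa> = (\<Prod>r\<leftarrow>rs. \<kappa> - r)" for rs \<kappa>
    by (induction rs) (simp_all add: P_def algebra_simps)
  have "f \<kappa> + g \<kappa> = poly (p * P ss + q * P rs) \<kappa> / (\<Prod>r\<leftarrow>rs @ ss. \<kappa> - r)"
    if "\<kappa> \<notin> set (rs @ ss)" for \<kappa>
    using that prod_list_diff_eq_0_iff[of \<kappa> rs] prod_list_diff_eq_0_iff[of \<kappa> ss]
    by (simp add: f g P add_frac_eq mult.commute)
  then show ?thesis
    unfolding confocal_rational_def using *
    by (intro exI[of _ "p * P ss + q * P rs"] exI[of _ "rs @ ss"]) auto
qed

lemma confocal_rational_uminus: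
  "confocal_rational a f \<Longrightarrow> confocal_rational a (\<lambda>\<kappa>. - f \<kappa>)"
  using confocal_rational_mult[OF confocal_rational_const[of a "-1"]] by fastforce

section \<open>Rational functions without poles\<close>

lemma bigo_tendsto_zero:
  fixes f g :: "'a \<Rightarrow> real"
  assumes "f \<in> O[F](g)" "(g \<longlongrightarrow> 0) F"
  shows "(f \<longlongrightarrow> 0) F"
proof -
  obtain c where "eventually (\<lambda>x. norm (f x) \<le> c * norm (g x)) F"
    using landau_o.bigE[OF assms(1)] by blast
  moreover have "((\<lambda>x. c * norm (g x)) \<longlongrightarrow> 0) F"
    by (rule tendsto_mult_right_zero[OF tendsto_norm_zero[OF assms(2)]])
  ultimately show ?thesis by (rule Lim_null_comparison)
qed

text \<open>The bound makes the numerator vanish at the first root, so one linear factor can be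
  split off and cancelled on both sides of the bound.\<close>

lemma poly_quotient_bounded:
  assumes "\<forall>\<mu>\<in>set rs. poly p \<in> O[at \<mu>](\<lambda>\<kappa>. \<Prod>r\<leftarrow>rs. \<kappa> - r :: real)"
  shows "\<exists>q. \<forall>\<kappa>. poly p \<kappa> = (\<Prod>r\<leftarrow>rs. \<kappa> - r) * poly q \<kappa>"
  using assms
proof (induction rs arbitrary: p)
  case (Cons r rs)
  have "((\<lambda>\<kappa>. \<Prod>s\<leftarrow>r # rs. \<kappa> - s) \<longlongrightarrow> (\<Prod>s\<leftarrow>r # rs. r - s)) (at r)"
    unfolding list.map prod_list.Cons
  proof (intro tendsto_mult tendsto_diff tendsto_ident_at tendsto_const)
    show "((\<lambda>\<kappa>. \<Prod>s\<leftarrow>rs. \<kappa> - s) \<longlongrightarrow> (\<Prod>s\<leftarrow>rs. r - s)) (at r)"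
    proof (induction rs)
      case (Cons s rs)
      then show ?case
        unfolding list.map prod_list.Cons
        by (intro tendsto_mult tendsto_diff tendsto_ident_at tendsto_const)
    qed simp
  qed
  then have "((\<lambda>\<kappa>. \<Prod>s\<leftarrow>r # rs. \<kappa> - s) \<longlongrightarrow> 0) (at r)" by simp
  moreover have "poly p \<in> O[at r](\<lambda>\<kappa>. \<Prod>s\<leftarrow>r # rs. \<kappa> - s)" using Cons.prems by simp
  ultimately have "(poly p \<longlongrightarrow> 0) (at r)" by (rule bigo_tendsto_zero[rotated])
  then have "poly p r = 0"
    using poly_isCont LIM_unique isCont_def by metis
  then obtain p' where p': "p = [:- r, 1:] * p'" by (metis dvdE poly_eq_0_iff_dvd)
  have "poly p' \<in> O[at \<mu>](\<lambda>\<kappa>. \<Prod>s\<leftarrow>rs. \<kappa> - s)" if "\<mu> \<in> set rs" for \<mu>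
  proof -
    have "(\<lambda>\<kappa>. (\<kappa> - r) * poly p' \<kappa>) \<in> O[at \<mu>](\<lambda>\<kappa>. (\<kappa> - r) * (\<Prod>s\<leftarrow>rs. \<kappa> - s))"
      using Cons.prems that by (simp add: p' algebra_simps)
    \<comment> \<open>The filter excludes \<mu> itself, so the factor may be cancelled even at a
      repeated root.\<close>
    moreover have "eventually (\<lambda>\<kappa>. \<kappa> - r \<noteq> 0) (at \<mu>)"
      using eventually_neq_at_within[of r \<mu> UNIV] by simp
    ultimately show ?thesis
      by (subst (asm) landau_o.big.mult_cancel_left) auto
  qed
  then obtain q where "\<And>\<kappa>. poly p' \<kappa> = (\<Prod>s\<leftarrow>rs. \<kappa> - s) * poly q \<kappa>"
    using Cons.IH by blast
  then show ?case by (intro exI[of _ q]) (simp add: p' algebra_simps)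
qed auto

text \<open>After subtraction of the limit, a nonzero polynomial or its negative would eventually
  stay above its positive leading coefficient.\<close>

lemma poly_limit_at_top:
  fixes p :: "real poly"
  assumes "(poly p \<longlongrightarrow> L) at_top"
  shows "p = [:L:]"
proof (rule ccontr)
  assume "p \<noteq> [:L:]"
  then have nz: "p - [:L:] \<noteq> 0" by simp
  have lim: "(poly (p - [:L:]) \<longlongrightarrow> 0) at_top"
  proof -
    have "poly (p - [:L:]) = (\<lambda>x. poly p x - L)" by auto
    then show ?thesis using tendsto_diff[OF assms tendsto_const[of L]] by simp
  qed
  have *: False if q: "(poly q \<longlongrightarrow> 0) at_top" "lead_coeff q > 0" for q :: "real poly"
  proof -
    obtain n where "\<forall>x\<ge>n. lead_coeff q \<le> poly q x" using poly_pinfty_gt_lc q(2) by blast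
    then have "eventually (\<lambda>x. lead_coeff q \<le> poly q x) at_top"
      unfolding eventually_at_top_linorder by blast
    from tendsto_lowerbound[OF q(1) this] q(2) show False by simp
  qed
  have "lead_coeff (p - [:L:]) > 0 \<or> lead_coeff (- (p - [:L:])) > 0"
    using nz leading_coeff_neq_0[OF nz] unfolding lead_coeff_minus by linarith
  moreover have "poly (- (p - [:L:])) = (\<lambda>x. - poly (p - [:L:]) x)" by auto
  then have "(poly (- (p - [:L:])) \<longlongrightarrow> 0) at_top" using tendsto_minus[OF lim] by simp
  ultimately show False using *[OF lim] * by blast
qed

text \<open>A form of Liouville's theorem: without poles the function is a polynomial, and its
  finite limit makes it constant. The conclusion is restricted to the points \<open>a $ i\<close>,
  because values at removed poles are arbitrary.\<close>

lemma confocal_rational_constant: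
  assumes f: "confocal_rational a f"
    and regular: "\<And>\<mu>. \<mu> \<in> confocal_params a \<Longrightarrow> f \<in> O[at \<mu>](\<lambda>_. 1)"
    and lim: "(f \<longlongrightarrow> L) at_top" and \<kappa>: "\<kappa> \<notin> confocal_params a"
  shows "f \<kappa> = L"
proof -
  obtain p rs where rs: "set rs \<subseteq> confocal_params a"
    and eq: "\<And>\<kappa>. \<kappa> \<notin> set rs \<Longrightarrow> f \<kappa> = poly p \<kappa> / (\<Prod>r\<leftarrow>rs. \<kappa> - r)"
    using f unfolding confocal_rational_def by blast
  have "poly p \<in> O[at \<mu>](\<lambda>\<kappa>. \<Prod>r\<leftarrow>rs. \<kappa> - r)" if "\<mu> \<in> set rs" for \<mu>
  proof -
    have "eventually (\<lambda>\<kappa>. \<kappa> \<notin> set rs) (at \<mu>)"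
      using islimpt_finite[of "set rs" \<mu>] by (simp add: islimpt_iff_eventually)
    then have "eventually (\<lambda>\<kappa>. poly p \<kappa> = f \<kappa> * (\<Prod>r\<leftarrow>rs. \<kappa> - r)) (at \<mu>)"
      by eventually_elim (simp add: eq prod_list_diff_eq_0_iff)
    moreover have "(\<lambda>\<kappa>. f \<kappa> * (\<Prod>r\<leftarrow>rs. \<kappa> - r)) \<in> O[at \<mu>](\<lambda>\<kappa>. 1 * (\<Prod>r\<leftarrow>rs. \<kappa> - r))"
      using regular that rs by (intro landau_o.big.mult) auto
    ultimately show ?thesis by (subst landau_o.big.in_cong) auto
  qed
  then obtain q where q: "\<And>\<kappa>. poly p \<kappa> = (\<Prod>r\<leftarrow>rs. \<kappa> - r) * poly q \<kappa>"
    using poly_quotient_bounded by blast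
  then have fq: "f \<kappa> = poly q \<kappa>" if "\<kappa> \<notin> set rs" for \<kappa>
    using that by (simp add: eq prod_list_diff_eq_0_iff)
  \<comment> \<open>Inserting 0 covers the empty list of poles, for which \<open>Max\<close> would
    be unspecified.\<close>
  have "eventually (\<lambda>\<kappa>. \<kappa> \<notin> set rs) at_top"
    using eventually_gt_at_top[of "Max (insert 0 (set rs))"]
    by eventually_elim (use Max_ge[of "insert 0 (set rs)"] in force)
  then have "eventually (\<lambda>\<kappa>. f \<kappa> = poly q \<kappa>) at_top"
    by eventually_elim (rule fq)
  then have "(poly q \<longlongrightarrow> L) at_top"
    using lim by (metis (mono_tags) tendsto_cong)
  then show ?thesis using poly_limit_at_top fq \<kappa> rs by fastforce
qed

section \<open>Two by two matrices\<close>

definition mat2 :: "real \<Rightarrow> real \<Rightarrow> real \<Rightarrow> real \<Rightarrow> real^2^2" where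
  "mat2 p q r s = vector [vector [p, q], vector [r, s]]"

lemma mat2_nth [simp]:
  "mat2 p q r s $ 1 $ 1 = p" "mat2 p q r s $ 1 $ 2 = q"
  "mat2 p q r s $ 2 $ 1 = r" "mat2 p q r s $ 2 $ 2 = s"
  by (simp_all add: mat2_def)

lemma matrix2_eq_iff:
  fixes A B :: "real^2^2"
  shows "A = B \<longleftrightarrow> A $ 1 $ 1 = B $ 1 $ 1 \<and> A $ 1 $ 2 = B $ 1 $ 2 \<and> A $ 2 $ 1 = B $ 2 $ 1 \<and> A $ 2 $ 2 = B $ 2 $ 2"
  by (auto simp: vec_eq_iff forall_2)

lemma matrix2_mult_nth:
  fixes A B :: "real^2^2"
  shows "(A ** B) $ i $ j = A $ i $ 1 * B $ 1 $ j + A $ i $ 2 * B $ 2 $ j"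
  by (simp add: matrix_matrix_mult_def sum_2)

lemma matrix2_scaleR_mult:
  fixes A B :: "real^2^2"
  shows "(r *\<^sub>R A) ** B = r *\<^sub>R (A ** B)" "A ** (r *\<^sub>R B) = r *\<^sub>R (A ** B)"
  by (simp_all add: matrix2_eq_iff matrix2_mult_nth algebra_simps)

lemma matrix2_add_mult:
  fixes A B C :: "real^2^2"
  shows "(A + B) ** C = A ** C + B ** C" "A ** (B + C) = A ** B + A ** C"
  by (simp_all add: matrix2_eq_iff matrix2_mult_nth algebra_simps)

lemma mat_1_eq: "mat 1 = mat2 1 0 0 1"
  by (simp add: matrix2_eq_iff mat_def)

lemma mat2_mult_vector: "mat2 p q r s *v vector [x, y] = vector [p * x + q * y, r * x + s * y]"
  by (simp add: vec_eq_iff forall_2 matrix_vector_mult_def sum_2)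

text \<open>The adjugate is the inverse for determinant 1. Its entries need no division, so
  rationality and growth bounds carry over directly.\<close>

definition adj2 :: "real^2^2 \<Rightarrow> real^2^2" where
  "adj2 A = mat2 (A $ 2 $ 2) (- (A $ 1 $ 2)) (- (A $ 2 $ 1)) (A $ 1 $ 1)"

lemma adj2_mult: "adj2 (A ** B) = adj2 B ** adj2 A"
  by (simp add: adj2_def matrix2_eq_iff matrix2_mult_nth)

lemma adj2_inverse:
  assumes "det A = 1"
  shows "adj2 A ** A = mat 1" "A ** adj2 A = mat 1"
  using assms by (simp_all add: adj2_def matrix2_eq_iff matrix2_mult_nth mat_1_eq det_2 algebra_simps)

lemma det_adj2: "det (adj2 A) = det A"
  by (simp add: adj2_def det_2 algebra_simps)

definition mat_bigo :: "'a filter \<Rightarrow> ('a \<Rightarrow> real^2^2) \<Rightarrow> ('a \<Rightarrow> real) \<Rightarrow> bool" where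
  "mat_bigo F M g \<longleftrightarrow> (\<forall>i j. (\<lambda>x. M x $ i $ j) \<in> O[F](g))"

lemma mat_bigo_mult:
  "mat_bigo F M g \<Longrightarrow> mat_bigo F N h \<Longrightarrow> mat_bigo F (\<lambda>x. M x ** N x) (\<lambda>x. g x * h x)"
  by (auto simp: mat_bigo_def matrix2_mult_nth intro!: sum_in_bigo landau_o.big.mult)

lemma mat_bigo_add:
  "mat_bigo F M g \<Longrightarrow> mat_bigo F N g \<Longrightarrow> mat_bigo F (\<lambda>x. M x + N x) g"
  by (auto simp: mat_bigo_def intro!: sum_in_bigo)

lemma mat_bigo_adj2: "mat_bigo F M g \<Longrightarrow> mat_bigo F (\<lambda>x. adj2 (M x)) g"
  by (simp add: mat_bigo_def adj2_def forall_2)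

lemma mat_bigo_cong:
  assumes "eventually (\<lambda>x. M x = N x) F" "mat_bigo F M g"
  shows "mat_bigo F N g"
  unfolding mat_bigo_def
proof (intro allI)
  fix i j
  have "eventually (\<lambda>x. M x $ i $ j = N x $ i $ j) F"
    using assms(1) by eventually_elim simp
  from landau_o.big.in_cong[OF this] show "(\<lambda>x. N x $ i $ j) \<in> O[F](g)"
    using assms(2) unfolding mat_bigo_def by blast
qed

lemma mat_bigo_trans:
  "mat_bigo F M g \<Longrightarrow> g \<in> O[F](h) \<Longrightarrow> mat_bigo F M h"
  unfolding mat_bigo_def using landau_o.big_trans by blast

lemma mat_bigo_tendsto:
  assumes "\<And>i j. ((\<lambda>x. M x $ i $ j) \<longlongrightarrow> C $ i $ j) F"
  shows "mat_bigo F M (\<lambda>_. 1)"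
  unfolding mat_bigo_def
proof (intro allI)
  fix i j
  show "(\<lambda>x. M x $ i $ j) \<in> O[F](\<lambda>_. 1)"
    by (rule bigoI_tendsto[where c = "C $ i $ j"]) (use assms[of i j] in simp_all)
qed

section \<open>Lax matrices\<close>

text \<open>Up to the constant -1 in the upper right corner, this is the sum over \<open>i\<close>
  of the rank one nilpotent matrices with column \<open>(x $ i, v $ i)\<close> and row
  \<open>(- v $ i, x $ i)\<close>, divided by \<open>a $ i - \<kappa>\<close>. The trace is 0 and
  the determinant is minus \<open>line_disc\<close>, so its characteristic equation is the spectral
  curve.\<close>

definition lax :: "real^'n \<Rightarrow> real^'n \<Rightarrow> real^'n \<Rightarrow> real \<Rightarrow> real^2^2" where
  "lax a x v \<kappa> = mat2 (- confocal_form a \<kappa> x v) (confocal_form a \<kappa> x x - 1)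
     (- confocal_form a \<kappa> v v) (confocal_form a \<kappa> x v)"

text \<open>The spectral projections of the Lax matrix, for the two signs \<open>\<sigma>\<close> of the eigenvalue; they
  only make sense where the discriminant is positive.\<close>

definition lax_proj :: "real \<Rightarrow> real^'n \<Rightarrow> real^'n \<Rightarrow> real^'n \<Rightarrow> real \<Rightarrow> real^2^2" where
  "lax_proj \<sigma> a x v \<kappa> = (1/2) *\<^sub>R (mat 1 + (\<sigma> / sqrt (line_disc a x v \<kappa>)) *\<^sub>R lax a x v \<kappa>)"

lemma lax_square: "lax a x v \<kappa> ** lax a x v \<kappa> = line_disc a x v \<kappa> *\<^sub>R mat 1"
  by (simp add: lax_def matrix2_eq_iff matrix2_mult_nth mat_1_eq line_disc_def
      power2_eq_square algebra_simps)

lemma lax_proj_add: "lax_proj 1 a x v \<kappa> + lax_proj (- 1) a x v \<kappa> = mat 1"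
  by (simp add: lax_proj_def matrix2_eq_iff mat_1_eq add_divide_distrib diff_divide_distrib)

text \<open>A traceless matrix changes its sign under the adjugate, so the two eigenvalues are
  exchanged. This is why inversion negates divisors.\<close>

lemma adj2_lax_proj: "adj2 (lax_proj \<sigma> a x v \<kappa>) = lax_proj (- \<sigma>) a x v \<kappa>"
  by (simp add: lax_proj_def adj2_def matrix2_eq_iff mat_1_eq lax_def)

lemma lax_proj_idem:
  assumes "line_disc a x v \<kappa> > 0" "\<sigma> * \<sigma> = 1"
  shows "lax_proj \<sigma> a x v \<kappa> ** lax_proj \<sigma> a x v \<kappa> = lax_proj \<sigma> a x v \<kappa>"
proof -
  define L r where "L = lax a x v \<kappa>" and "r = \<sigma> / sqrt (line_disc a x v \<kappa>)"
  have "r * r * line_disc a x v \<kappa> = 1" using assms by (simp add: r_def)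
  then have "r * (r * line_disc a x v \<kappa>) = 1" by (simp only: mult.assoc)
  then have LL: "(r *\<^sub>R L) ** (r *\<^sub>R L) = mat 1"
    by (simp add: L_def matrix2_scaleR_mult lax_square)
  have "(mat 1 + r *\<^sub>R L) ** (mat 1 + r *\<^sub>R L) = 2 *\<^sub>R (mat 1 + r *\<^sub>R L)"
    unfolding matrix2_add_mult LL by (simp add: scaleR_2)
  then show ?thesis unfolding lax_proj_def L_def[symmetric] r_def[symmetric]
    by (simp add: matrix2_scaleR_mult)
qed

section \<open>Behaviour of Lax matrices near a parameter\<close>

lemma confocal_form_tendsto:
  "\<mu> \<in> confocal_params a \<Longrightarrow> ((\<lambda>\<kappa>. confocal_form a \<kappa> x y) \<longlongrightarrow> confocal_form a \<mu> x y) (at \<mu>)"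
  unfolding confocal_form_def confocal_params_def
  by (intro tendsto_sum tendsto_divide tendsto_const tendsto_diff tendsto_ident_at) (auto dest: spec)

lemma line_disc_tendsto:
  "\<mu> \<in> confocal_params a \<Longrightarrow> (line_disc a x v \<longlongrightarrow> line_disc a x v \<mu>) (at \<mu>)"
  unfolding line_disc_def[abs_def] by (intro tendsto_intros confocal_form_tendsto)

lemma eventually_line_disc_pos:
  "\<mu> \<in> confocal_params a \<Longrightarrow> line_disc a x v \<mu> > 0 \<Longrightarrow> eventually (\<lambda>\<kappa>. line_disc a x v \<kappa> > 0) (at \<mu>)"
  using line_disc_tendsto order_tendstoD(1) by blast

lemma eventually_confocal_params:
  fixes a :: "real^'n"
  assumes "\<mu> \<in> confocal_params a"
  shows "eventually (\<lambda>\<kappa>. \<kappa> \<in> confocal_params a) (at \<mu>)"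
proof -
  have "confocal_params a = - range (\<lambda>i. a $ i)" by (auto simp: confocal_params_def)
  then have "open (confocal_params a)" by (simp add: open_Compl finite_imp_closed)
  then show ?thesis using assms by (intro eventually_at_in_open') auto
qed

lemma mat_bigo_lax_proj:
  assumes "\<mu> \<in> confocal_params a" "line_disc a x v \<mu> > 0"
  shows "mat_bigo (at \<mu>) (lax_proj \<sigma> a x v) (\<lambda>_. 1)"
proof (rule mat_bigo_tendsto)
  fix i j :: 2
  have "((\<lambda>\<kappa>. lax a x v \<kappa> $ i $ j) \<longlongrightarrow> lax a x v \<mu> $ i $ j) (at \<mu>)"
    using exhaust_2[of i] exhaust_2[of j]
    by (elim disjE; simp add: lax_def; intro tendsto_intros confocal_form_tendsto assms(1))
  then show "((\<lambda>\<kappa>. lax_proj \<sigma> a x v \<kappa> $ i $ j) \<longlongrightarrow> lax_proj \<sigma> a x v \<mu> $ i $ j) (at \<mu>)"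
    unfolding lax_proj_def vector_scaleR_component vector_add_component real_scaleR_def
    using assms
    by (intro tendsto_mult tendsto_add tendsto_divide tendsto_real_sqrt tendsto_const line_disc_tendsto)
      auto
qed

section \<open>Transfer matrices\<close>

text \<open>\<open>e\<close> is the divisor of \<open>M\<close> on the spectral curve: order \<open>e \<mu>\<close> at the point over \<open>\<mu>\<close> with positive
  eigenvalue and \<open>- e \<mu>\<close> at its conjugate. Only real points matter, because all poles are real.\<close>

definition transfer ::
    "real^'n \<Rightarrow> (real \<Rightarrow> real^2^2) \<Rightarrow> real^'n \<Rightarrow> real^'n \<Rightarrow> real^'n \<Rightarrow> real^'n \<Rightarrow> (real \<Rightarrow> real) \<Rightarrow> bool" where
  "transfer a M x v x' v' e \<longleftrightarrow>
     (\<forall>i j. confocal_rational a (\<lambda>\<kappa>. M \<kappa> $ i $ j)) \<and>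
     (\<forall>\<kappa>. det (M \<kappa>) = 1) \<and>
     (\<exists>t. \<forall>i j. ((\<lambda>\<kappa>. M \<kappa> $ i $ j) \<longlongrightarrow> mat2 1 t 0 1 $ i $ j) at_top) \<and>
     (\<forall>i. M (a $ i) *v vector [x $ i, v $ i] = vector [x' $ i, v' $ i]) \<and>
     (\<forall>\<kappa>\<in>confocal_params a. line_disc a x' v' \<kappa> = line_disc a x v \<kappa>) \<and>
     (\<forall>\<mu>\<in>confocal_params a. eventually (\<lambda>\<kappa>. M \<kappa> ** lax a x v \<kappa> = lax a x' v' \<kappa> ** M \<kappa>) (at \<mu>)) \<and>
     (\<forall>\<mu>\<in>confocal_params a.
        if line_disc a x v \<mu> > 0
        then mat_bigo (at \<mu>) (\<lambda>\<kappa>. M \<kappa> ** lax_proj 1 a x v \<kappa>) (\<lambda>\<kappa>. \<bar>\<kappa> - \<mu>\<bar> powr e \<mu>) \<and>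
             mat_bigo (at \<mu>) (\<lambda>\<kappa>. M \<kappa> ** lax_proj (- 1) a x v \<kappa>) (\<lambda>\<kappa>. \<bar>\<kappa> - \<mu>\<bar> powr - e \<mu>)
        else mat_bigo (at \<mu>) M (\<lambda>_. 1))"

lemma transferD:
  assumes "transfer a M x v x' v' e"
  shows "confocal_rational a (\<lambda>\<kappa>. M \<kappa> $ i $ j)"
    and "det (M \<kappa>) = 1"
    and "\<exists>t. \<forall>i j. ((\<lambda>\<kappa>. M \<kappa> $ i $ j) \<longlongrightarrow> mat2 1 t 0 1 $ i $ j) at_top"
    and "M (a $ k) *v vector [x $ k, v $ k] = vector [x' $ k, v' $ k]"
    and "\<kappa> \<in> confocal_params a \<Longrightarrow> line_disc a x' v' \<kappa> = line_disc a x v \<kappa>"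
    and "\<mu> \<in> confocal_params a \<Longrightarrow> eventually (\<lambda>\<kappa>. M \<kappa> ** lax a x v \<kappa> = lax a x' v' \<kappa> ** M \<kappa>) (at \<mu>)"
    and "\<mu> \<in> confocal_params a \<Longrightarrow> line_disc a x v \<mu> > 0 \<Longrightarrow>
      mat_bigo (at \<mu>) (\<lambda>\<kappa>. M \<kappa> ** lax_proj 1 a x v \<kappa>) (\<lambda>\<kappa>. \<bar>\<kappa> - \<mu>\<bar> powr e \<mu>)"
    and "\<mu> \<in> confocal_params a \<Longrightarrow> line_disc a x v \<mu> > 0 \<Longrightarrow>
      mat_bigo (at \<mu>) (\<lambda>\<kappa>. M \<kappa> ** lax_proj (- 1) a x v \<kappa>) (\<lambda>\<kappa>. \<bar>\<kappa> - \<mu>\<bar> powr - e \<mu>)"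
    and "\<mu> \<in> confocal_params a \<Longrightarrow> \<not> line_disc a x v \<mu> > 0 \<Longrightarrow> mat_bigo (at \<mu>) M (\<lambda>_. 1)"
  using assms unfolding transfer_def by presburger+

lemma lax_proj_intertwine:
  assumes "M ** lax a x v \<kappa> = lax a x' v' \<kappa> ** M" "line_disc a x' v' \<kappa> = line_disc a x v \<kappa>"
  shows "M ** lax_proj \<sigma> a x v \<kappa> = lax_proj \<sigma> a x' v' \<kappa> ** M"
  by (simp add: lax_proj_def assms matrix2_scaleR_mult matrix2_add_mult)

lemma transfer_lax_proj:
  assumes "transfer a M x v x' v' e" "\<mu> \<in> confocal_params a"
  shows "eventually (\<lambda>\<kappa>. M \<kappa> ** lax_proj \<sigma> a x v \<kappa> = lax_proj \<sigma> a x' v' \<kappa> ** M \<kappa>) (at \<mu>)"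
  using transferD(6)[OF assms] eventually_confocal_params[OF assms(2)]
  by eventually_elim (auto intro: lax_proj_intertwine transferD(5)[OF assms(1)])

lemma transfer_compose:
  assumes M: "transfer a M x v x' v' e" and N: "transfer a N x' v' x'' v'' f"
  shows "transfer a (\<lambda>\<kappa>. N \<kappa> ** M \<kappa>) x v x'' v'' (\<lambda>\<mu>. e \<mu> + f \<mu>)"
  unfolding transfer_def
proof (intro conjI allI ballI)
  fix i j
  show "confocal_rational a (\<lambda>\<kappa>. (N \<kappa> ** M \<kappa>) $ i $ j)"
    unfolding matrix2_mult_nth
    by (intro confocal_rational_add confocal_rational_mult transferD(1)[OF M] transferD(1)[OF N])
next
  fix \<kappa> show "det (N \<kappa> ** M \<kappa>) = 1" by (simp add: det_mul transferD(2)[OF M] transferD(2)[OF N])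
next
  obtain s t where "\<And>i j. ((\<lambda>\<kappa>. M \<kappa> $ i $ j) \<longlongrightarrow> mat2 1 s 0 1 $ i $ j) at_top"
    "\<And>i j. ((\<lambda>\<kappa>. N \<kappa> $ i $ j) \<longlongrightarrow> mat2 1 t 0 1 $ i $ j) at_top"
    using transferD(3)[OF M] transferD(3)[OF N] by blast
  then have "((\<lambda>\<kappa>. (N \<kappa> ** M \<kappa>) $ i $ j) \<longlongrightarrow> (mat2 1 t 0 1 ** mat2 1 s 0 1) $ i $ j) at_top" for i j
    unfolding matrix2_mult_nth by (intro tendsto_add tendsto_mult)
  moreover have "mat2 1 t 0 1 ** mat2 1 s 0 1 = mat2 1 (s + t) 0 1"
    by (simp add: matrix2_eq_iff matrix2_mult_nth)
  ultimately show "\<exists>t. \<forall>i j. ((\<lambda>\<kappa>. (N \<kappa> ** M \<kappa>) $ i $ j) \<longlongrightarrow> mat2 1 t 0 1 $ i $ j) at_top"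
    by (intro exI[of _ "s + t"]) simp
next
  fix i
  show "(N (a $ i) ** M (a $ i)) *v vector [x $ i, v $ i] = vector [x'' $ i, v'' $ i]"
    by (simp add: matrix_vector_mul_assoc[symmetric] transferD(4)[OF M] transferD(4)[OF N])
next
  fix \<kappa> assume "\<kappa> \<in> confocal_params a"
  then show "line_disc a x'' v'' \<kappa> = line_disc a x v \<kappa>"
    by (simp add: transferD(5)[OF M] transferD(5)[OF N])
next
  fix \<mu> assume \<mu>: "\<mu> \<in> confocal_params a"
  from transferD(6)[OF M \<mu>] transferD(6)[OF N \<mu>]
  show "eventually (\<lambda>\<kappa>. N \<kappa> ** M \<kappa> ** lax a x v \<kappa> = lax a x'' v'' \<kappa> ** (N \<kappa> ** M \<kappa>)) (at \<mu>)"
    by eventually_elim (metis matrix_mul_assoc)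
next
  fix \<mu> assume \<mu>: "\<mu> \<in> confocal_params a"
  have disc: "line_disc a x' v' \<mu> = line_disc a x v \<mu>" using transferD(5)[OF M \<mu>] .
  show "if line_disc a x v \<mu> > 0
    then mat_bigo (at \<mu>) (\<lambda>\<kappa>. N \<kappa> ** M \<kappa> ** lax_proj 1 a x v \<kappa>) (\<lambda>\<kappa>. \<bar>\<kappa> - \<mu>\<bar> powr (e \<mu> + f \<mu>)) \<and>
         mat_bigo (at \<mu>) (\<lambda>\<kappa>. N \<kappa> ** M \<kappa> ** lax_proj (- 1) a x v \<kappa>) (\<lambda>\<kappa>. \<bar>\<kappa> - \<mu>\<bar> powr - (e \<mu> + f \<mu>))
    else mat_bigo (at \<mu>) (\<lambda>\<kappa>. N \<kappa> ** M \<kappa>) (\<lambda>_. 1)"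
  proof (cases "line_disc a x v \<mu> > 0")
    case True
    have *: "mat_bigo (at \<mu>) (\<lambda>\<kappa>. N \<kappa> ** M \<kappa> ** lax_proj \<sigma> a x v \<kappa>) (\<lambda>\<kappa>. \<bar>\<kappa> - \<mu>\<bar> powr (p + q))"
      if MO: "mat_bigo (at \<mu>) (\<lambda>\<kappa>. M \<kappa> ** lax_proj \<sigma> a x v \<kappa>) (\<lambda>\<kappa>. \<bar>\<kappa> - \<mu>\<bar> powr p)"
        and NO: "mat_bigo (at \<mu>) (\<lambda>\<kappa>. N \<kappa> ** lax_proj \<sigma> a x' v' \<kappa>) (\<lambda>\<kappa>. \<bar>\<kappa> - \<mu>\<bar> powr q)"
        and \<sigma>: "\<sigma> * \<sigma> = 1" for \<sigma> p q
    proof -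
      \<comment> \<open>The projection is idempotent and is carried to the projection of the middle
        line. Inserting the latter splits the product into two factors of known order, so the orders
        add.\<close>
      have "eventually (\<lambda>\<kappa>. (N \<kappa> ** lax_proj \<sigma> a x' v' \<kappa>) ** (M \<kappa> ** lax_proj \<sigma> a x v \<kappa>) =
          N \<kappa> ** M \<kappa> ** lax_proj \<sigma> a x v \<kappa>) (at \<mu>)"
        using transfer_lax_proj[OF M \<mu>, of \<sigma>] eventually_line_disc_pos[OF \<mu> True]
      proof eventually_elim
        case (elim \<kappa>)
        have "(N \<kappa> ** lax_proj \<sigma> a x' v' \<kappa>) ** (M \<kappa> ** lax_proj \<sigma> a x v \<kappa>) =
            N \<kappa> ** ((lax_proj \<sigma> a x' v' \<kappa> ** M \<kappa>) ** lax_proj \<sigma> a x v \<kappa>)"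
          by (simp only: matrix_mul_assoc)
        also have "\<dots> = N \<kappa> ** M \<kappa> ** (lax_proj \<sigma> a x v \<kappa> ** lax_proj \<sigma> a x v \<kappa>)"
          by (simp only: elim(1)[symmetric] matrix_mul_assoc)
        finally show ?case by (simp only: lax_proj_idem[OF elim(2) \<sigma>])
      qed
      then show ?thesis
        using mat_bigo_mult[OF NO MO] by (subst add.commute) (simp only: powr_add, rule mat_bigo_cong)
    qed
    show ?thesis
      using *[OF transferD(7)[OF M \<mu> True] transferD(7)[OF N \<mu>]]
        *[OF transferD(8)[OF M \<mu> True] transferD(8)[OF N \<mu>]] True disc
      by simp
  next
    case False
    then have "mat_bigo (at \<mu>) M (\<lambda>_. 1)" "mat_bigo (at \<mu>) N (\<lambda>_. 1)"
      using transferD(9)[OF M \<mu>] transferD(9)[OF N \<mu>] disc by auto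
    from mat_bigo_mult[OF this(2,1)] show ?thesis using False by simp
  qed
qed

lemma transfer_inverse:
  assumes M: "transfer a M x v x' v' e"
  shows "transfer a (\<lambda>\<kappa>. adj2 (M \<kappa>)) x' v' x v (\<lambda>\<mu>. - e \<mu>)"
  unfolding transfer_def
proof (intro conjI allI ballI)
  fix i j :: 2
  show "confocal_rational a (\<lambda>\<kappa>. adj2 (M \<kappa>) $ i $ j)"
    using exhaust_2[of i] exhaust_2[of j] 
    by (auto simp: adj2_def intro!: confocal_rational_uminus transferD(1)[OF M])
next
  fix \<kappa> show "det (adj2 (M \<kappa>)) = 1" by (simp add: det_adj2 transferD(2)[OF M])
next
  obtain t where t: "\<And>i j. ((\<lambda>\<kappa>. M \<kappa> $ i $ j) \<longlongrightarrow> mat2 1 t 0 1 $ i $ j) at_top"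
    using transferD(3)[OF M] by blast
  have "((\<lambda>\<kappa>. adj2 (M \<kappa>) $ i $ j) \<longlongrightarrow> mat2 1 (- t) 0 1 $ i $ j) at_top" for i j :: 2
    using exhaust_2[of i] exhaust_2[of j] t[of 1 1] t[of 1 2] t[of 2 1] t[of 2 2]
    by (auto simp: adj2_def intro: tendsto_minus tendsto_minus[where a = 0, simplified])
  then show "\<exists>t. \<forall>i j. ((\<lambda>\<kappa>. adj2 (M \<kappa>) $ i $ j) \<longlongrightarrow> mat2 1 t 0 1 $ i $ j) at_top" by blast
next
  fix i
  show "adj2 (M (a $ i)) *v vector [x' $ i, v' $ i] = vector [x $ i, v $ i]"
    unfolding transferD(4)[OF M, symmetric] matrix_vector_mul_assoc
    by (simp add: adj2_inverse transferD(2)[OF M])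
next
  fix \<kappa> assume "\<kappa> \<in> confocal_params a"
  then show "line_disc a x v \<kappa> = line_disc a x' v' \<kappa>" using transferD(5)[OF M] by simp
next
  fix \<mu> assume \<mu>: "\<mu> \<in> confocal_params a"
  note d = transferD(2)[OF M]
  from transferD(6)[OF M \<mu>] show "eventually (\<lambda>\<kappa>. adj2 (M \<kappa>) ** lax a x' v' \<kappa> = lax a x v \<kappa> ** adj2 (M \<kappa>)) (at \<mu>)"
  proof eventually_elim
    case (elim \<kappa>)
    have "adj2 (M \<kappa>) ** lax a x' v' \<kappa> = adj2 (M \<kappa>) ** (lax a x' v' \<kappa> ** M \<kappa>) ** adj2 (M \<kappa>)"
      by (simp add: matrix_mul_assoc[symmetric] adj2_inverse d)
    also have "\<dots> = (adj2 (M \<kappa>) ** M \<kappa>) ** lax a x v \<kappa> ** adj2 (M \<kappa>)"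
      by (simp only: elim(1)[symmetric] matrix_mul_assoc)
    finally show ?case by (simp add: adj2_inverse[OF d])
  qed
next
  fix \<mu> assume \<mu>: "\<mu> \<in> confocal_params a"
  have disc: "line_disc a x' v' \<mu> = line_disc a x v \<mu>" using transferD(5)[OF M \<mu>] .
  have *: "mat_bigo (at \<mu>) (\<lambda>\<kappa>. adj2 (M \<kappa>) ** lax_proj \<sigma> a x' v' \<kappa>) g"
    if "mat_bigo (at \<mu>) (\<lambda>\<kappa>. M \<kappa> ** lax_proj (- \<sigma>) a x v \<kappa>) g" for \<sigma> g
  proof (rule mat_bigo_cong[OF _ mat_bigo_adj2[OF that]])
    show "eventually (\<lambda>\<kappa>. adj2 (M \<kappa> ** lax_proj (- \<sigma>) a x v \<kappa>) =
        adj2 (M \<kappa>) ** lax_proj \<sigma> a x' v' \<kappa>) (at \<mu>)"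
      using transfer_lax_proj[OF M \<mu>, of "- \<sigma>"]
      by eventually_elim (simp add: adj2_mult adj2_lax_proj)
  qed
  show "if line_disc a x' v' \<mu> > 0
    then mat_bigo (at \<mu>) (\<lambda>\<kappa>. adj2 (M \<kappa>) ** lax_proj 1 a x' v' \<kappa>) (\<lambda>\<kappa>. \<bar>\<kappa> - \<mu>\<bar> powr - e \<mu>) \<and>
         mat_bigo (at \<mu>) (\<lambda>\<kappa>. adj2 (M \<kappa>) ** lax_proj (- 1) a x' v' \<kappa>) (\<lambda>\<kappa>. \<bar>\<kappa> - \<mu>\<bar> powr - (- e \<mu>))
    else mat_bigo (at \<mu>) (\<lambda>\<kappa>. adj2 (M \<kappa>)) (\<lambda>_. 1)"
    using transferD(7-9)[OF M \<mu>] disc *[of 1] *[of "- 1"] mat_bigo_adj2[of "at \<mu>" M "\<lambda>_. 1"]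
    by simp
qed

text \<open>A transfer matrix without poles is constant.\<close>

lemma transfer_trivial_divisor:
  fixes a :: "real^'n"
  assumes M: "transfer a M x v x' v' e" and e: "\<And>\<mu>. e \<mu> = 0"
  obtains t where "v' = v" "x' = x + t *\<^sub>R v"
proof -
  obtain t where t: "\<And>i j. ((\<lambda>\<kappa>. M \<kappa> $ i $ j) \<longlongrightarrow> mat2 1 t 0 1 $ i $ j) at_top"
    using transferD(3)[OF M] by blast
  have "mat_bigo (at \<mu>) M (\<lambda>_. 1)" if \<mu>: "\<mu> \<in> confocal_params a" for \<mu>
  proof (cases "line_disc a x v \<mu> > 0")
    case True
    have "(\<lambda>\<kappa>. \<bar>\<kappa> - \<mu>\<bar> powr 0) \<in> O[at \<mu>](\<lambda>_. 1)"
      by (rule landau_o.bigI[of 1]) (auto simp: powr_def)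
    \<comment> \<open>The projections add up to the identity, so bounds along both eigenvectors
      bound the whole matrix.\<close>
    then have "mat_bigo (at \<mu>) (\<lambda>\<kappa>. M \<kappa> ** lax_proj 1 a x v \<kappa> + M \<kappa> ** lax_proj (- 1) a x v \<kappa>) (\<lambda>_. 1)"
      using transferD(7,8)[OF M \<mu> True] e by (intro mat_bigo_add) (auto intro: mat_bigo_trans)
    moreover have "M \<kappa> ** lax_proj 1 a x v \<kappa> + M \<kappa> ** lax_proj (- 1) a x v \<kappa> = M \<kappa>" for \<kappa>
      by (simp add: matrix2_add_mult[symmetric] lax_proj_add)
    ultimately show ?thesis by simp
  next
    case False
    then show ?thesis by (rule transferD(9)[OF M \<mu>])
  qed
  then have "M (a $ k) $ i $ j = mat2 1 t 0 1 $ i $ j" for i j k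
    using transferD(1)[OF M] t by (intro confocal_rational_constant[of a "\<lambda>\<kappa>. M \<kappa> $ i $ j"])
      (auto simp: mat_bigo_def confocal_params_def)
  then have "M (a $ k) = mat2 1 t 0 1" for k by (simp add: vec_eq_iff)
  then have *: "vector [x' $ k, v' $ k] = (vector [x $ k + t * v $ k, v $ k] :: real^2)" for k
    using transferD(4)[OF M, of k] by (simp add: mat2_mult_vector)
  have "v' $ k = v $ k" "x' $ k = x $ k + t * v $ k" for k
    using arg_cong[OF *[of k], of "\<lambda>w. w $ 1"] arg_cong[OF *[of k], of "\<lambda>w. w $ 2"] by simp_all
  then show ?thesis using that[of t] by (simp add: vec_eq_iff)
qed

section \<open>Transfer matrices of shifts and reflections\<close>

lemma mat_bigo_order_0:
  assumes "mat_bigo (at \<mu>) M (\<lambda>_. 1)"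
  shows "mat_bigo (at \<mu>) M (\<lambda>\<kappa>. \<bar>\<kappa> - \<mu>\<bar> powr 0)"
proof (rule mat_bigo_trans[OF assms])
  \<comment> \<open>Since \<open>0 powr 0\<close> is 0, the comparison with 1 holds only away from
    \<mu>.\<close>
  have "eventually (\<lambda>\<kappa>. \<kappa> \<noteq> \<mu>) (at \<mu>)" by (rule eventually_neq_at_within)
  then have "eventually (\<lambda>\<kappa>. norm (1 :: real) \<le> 1 * norm (\<bar>\<kappa> - \<mu>\<bar> powr 0)) (at \<mu>)"
    by eventually_elim simp
  then show "(\<lambda>_. 1) \<in> O[at \<mu>](\<lambda>\<kappa>. \<bar>\<kappa> - \<mu>\<bar> powr 0)" by (rule landau_o.bigI[rotated]) simp
qed

lemma mat_bigo_regular: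
  assumes "mat_bigo (at \<mu>) M (\<lambda>_. 1)" "\<mu> \<in> confocal_params a" "line_disc a x v \<mu> > 0"
  shows "mat_bigo (at \<mu>) (\<lambda>\<kappa>. M \<kappa> ** lax_proj \<sigma> a x v \<kappa>) (\<lambda>\<kappa>. \<bar>\<kappa> - \<mu>\<bar> powr 0)"
  using mat_bigo_mult[OF assms(1) mat_bigo_lax_proj[OF assms(2,3)]]
  by (intro mat_bigo_order_0) simp

text \<open>Moving the base point multiplies all pairs \<open>(x $ i, v $ i)\<close> by one constant
  unipotent matrix, which has no poles. The free entry \<open>t\<close> of the limit at infinity in
  \<open>transfer\<close> leaves room for it.\<close>

lemma transfer_shift:
  "transfer a (\<lambda>_. mat2 1 t 0 1) x v (x + t *\<^sub>R v) v (\<lambda>_. 0)"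
  unfolding transfer_def
proof (intro conjI allI ballI)
  fix \<mu> assume \<mu>: "\<mu> \<in> confocal_params a"
  have reg: "mat_bigo (at \<mu>) (\<lambda>_. mat2 1 t 0 1) (\<lambda>_. 1)"
    by (rule mat_bigo_tendsto) (rule tendsto_const)
  show "if line_disc a x v \<mu> > 0
    then mat_bigo (at \<mu>) (\<lambda>\<kappa>. mat2 1 t 0 1 ** lax_proj 1 a x v \<kappa>) (\<lambda>\<kappa>. \<bar>\<kappa> - \<mu>\<bar> powr 0) \<and>
         mat_bigo (at \<mu>) (\<lambda>\<kappa>. mat2 1 t 0 1 ** lax_proj (- 1) a x v \<kappa>) (\<lambda>\<kappa>. \<bar>\<kappa> - \<mu>\<bar> powr - 0)
    else mat_bigo (at \<mu>) (\<lambda>_. mat2 1 t 0 1) (\<lambda>_. 1)"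
    using mat_bigo_regular[OF reg \<mu>] reg by (simp del: powr_zero_eq_one)
next
  fix \<mu>
  have "mat2 1 t 0 1 ** lax a x v \<kappa> = lax a (x + t *\<^sub>R v) v \<kappa> ** mat2 1 t 0 1" for \<kappa>
    by (simp add: lax_def matrix2_eq_iff matrix2_mult_nth confocal_form_commute[of a \<kappa> v x] algebra_simps)
  then show "eventually (\<lambda>\<kappa>. mat2 1 t 0 1 ** lax a x v \<kappa> = lax a (x + t *\<^sub>R v) v \<kappa> ** mat2 1 t 0 1) (at \<mu>)"
    by simp
qed (auto simp: confocal_rational_const det_2 mat2_mult_vector line_disc_shift)

lemma bigo_order_1:
  fixes f h :: "real \<Rightarrow> real"
  assumes "eventually (\<lambda>\<kappa>. f \<kappa> = (\<kappa> - \<mu>) * h \<kappa>) (at \<mu>)" "(h \<longlongrightarrow> c) (at \<mu>)"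
  shows "f \<in> O[at \<mu>](\<lambda>\<kappa>. \<bar>\<kappa> - \<mu>\<bar> powr 1)"
proof -
  have "(\<lambda>\<kappa>. \<kappa> - \<mu>) \<in> O[at \<mu>](\<lambda>\<kappa>. \<bar>\<kappa> - \<mu>\<bar> powr 1)"
    by (rule landau_o.bigI[of 1]) auto
  moreover have "h \<in> O[at \<mu>](\<lambda>_. 1)"
    using assms(2) by (intro bigoI_tendsto[where c = c]) simp_all
  ultimately have "(\<lambda>\<kappa>. (\<kappa> - \<mu>) * h \<kappa>) \<in> O[at \<mu>](\<lambda>\<kappa>. \<bar>\<kappa> - \<mu>\<bar> powr 1 * 1)"
    by (rule landau_o.big.mult)
  then show ?thesis using landau_o.big.in_cong[OF assms(1)] by simp
qed

text \<open>At \<open>\<kappa> = \<mu>\<close> this is the identity matrix because \<open>x / 0 = 0\<close>; hence the determinant is 1 everywhere.\<close>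

definition reflection_matrix :: "real^'n \<Rightarrow> real \<Rightarrow> real^'n \<Rightarrow> real^'n \<Rightarrow> real \<Rightarrow> real^2^2" where
  "reflection_matrix a \<mu> x v \<kappa> =
     mat2 1 0 (- (2 * (v \<bullet> normal_vec a \<mu> x) / (normal_vec a \<mu> x \<bullet> normal_vec a \<mu> x) / (\<kappa> - \<mu>))) 1"

text \<open>The reflection matrix has a simple pole, but it vanishes on the eigenvector over \<open>\<mu>\<close> whose
  eigenvalue is \<open>normal_vec a \<mu> x \<bullet> v\<close>.\<close>

lemma reflection_matrix_zero:
  fixes a x v :: "real^'n"
  assumes \<mu>: "\<mu> \<in> confocal_params a" and x: "x \<in> quadric a \<mu>" and b: "normal_vec a \<mu> x \<bullet> v \<noteq> 0"
  shows "mat_bigo (at \<mu>)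
    (\<lambda>\<kappa>. reflection_matrix a \<mu> x v \<kappa> ** lax_proj (sgn (normal_vec a \<mu> x \<bullet> v)) a x v \<kappa>)
    (\<lambda>\<kappa>. \<bar>\<kappa> - \<mu>\<bar> powr 1)"
proof -
  define n \<sigma> w where "n = normal_vec a \<mu> x" and "\<sigma> = sgn (n \<bullet> v)" and "w = mirror n v"
  have n0: "n \<noteq> 0" using normal_vec_nonzero[OF x] by (simp add: n_def)
  \<comment> \<open>\<open>y\<close> is the branch of the eigenvalue that equals
    \<open>n \<bullet> v\<close> at \<mu>. Primed quantities below belong to the reflected direction
    \<open>w\<close>.\<close>
  define y F where "y \<kappa> = \<sigma> * sqrt (line_disc a x v \<kappa>)" and "F \<kappa> = confocal_form a \<kappa> x n" for \<kappa>
  define U V U' V' where "U \<kappa> = confocal_form a \<kappa> v v" and "V \<kappa> = confocal_form a \<kappa> x v"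
    and "U' \<kappa> = confocal_form a \<kappa> w w" and "V' \<kappa> = confocal_form a \<kappa> x w" for \<kappa>
  have b: "n \<bullet> v \<noteq> 0" using b by (simp add: n_def)
  have \<sigma>: "\<sigma> * \<sigma> = 1" "\<sigma> \<noteq> 0" using b by (auto simp: \<sigma>_def sgn_if)
  have D: "line_disc a x v \<mu> = (n \<bullet> v)\<^sup>2" using line_disc_at[OF x] by (simp add: n_def)
  then have D0: "line_disc a x v \<mu> > 0" using b by simp
  have "y \<mu> = n \<bullet> v" by (simp add: y_def D \<sigma>_def sgn_if)
  then have y: "(y \<longlongrightarrow> n \<bullet> v) (at \<mu>)"
    using tendsto_mult[OF tendsto_const[of \<sigma>] tendsto_real_sqrt[OF line_disc_tendsto[OF \<mu>, of x v]]]
    by (simp add: y_def[abs_def])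
  have lim: "(F \<longlongrightarrow> F \<mu>) (at \<mu>)" "(U \<longlongrightarrow> U \<mu>) (at \<mu>)" "(U' \<longlongrightarrow> U' \<mu>) (at \<mu>)"
    "(V \<longlongrightarrow> V \<mu>) (at \<mu>)" "(V' \<longlongrightarrow> V' \<mu>) (at \<mu>)"
    unfolding F_def U_def U'_def V_def V'_def by (intro confocal_form_tendsto \<mu>)+
  have V\<mu>: "V \<mu> = n \<bullet> v" "V' \<mu> = - (n \<bullet> v)"
    using mirror_inner[OF n0, of v] by (simp_all add: V_def V'_def w_def n_def normal_vec_inner)
  have lim1: "((\<lambda>\<kappa>. y \<kappa> - V' \<kappa>) \<longlongrightarrow> 2 * (n \<bullet> v)) (at \<mu>)"
    and lim2: "((\<lambda>\<kappa>. y \<kappa> + V \<kappa>) \<longlongrightarrow> 2 * (n \<bullet> v)) (at \<mu>)"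
    using tendsto_diff[OF y lim(5)] tendsto_add[OF y lim(4)] by (simp_all add: V\<mu>)
  have ev: "eventually (\<lambda>\<kappa>. y \<kappa> - V' \<kappa> \<noteq> 0) (at \<mu>)" "eventually (\<lambda>\<kappa>. y \<kappa> + V \<kappa> \<noteq> 0) (at \<mu>)"
    using tendsto_imp_eventually_ne[OF lim1, of 0] tendsto_imp_eventually_ne[OF lim2, of 0] b
    by simp_all
  \<comment> \<open>The projection has rank one, and \<open>g\<close> is the quotient of its two
    columns; \<open>h\<close> is the second column of the product divided by
    \<open>\<kappa> - \<mu>\<close>. The denominators \<open>y + V\<close> and \<open>y - V'\<close>
    are harmless, as both tend to \<open>2 * (n \<bullet> v)\<close>.\<close>
  define g h where "g \<kappa> = - U \<kappa> / (y \<kappa> + V \<kappa>)"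
    and "h i \<kappa> = (if i = (1::2) then F \<kappa> / (2 * y \<kappa>) else - U' \<kappa> * F \<kappa> / ((y \<kappa> - V' \<kappa>) * (2 * y \<kappa>)))"
    for \<kappa> i
  have gl: "(g \<longlongrightarrow> - U \<mu> / (2 * (n \<bullet> v))) (at \<mu>)"
    unfolding g_def[abs_def] using b by (intro tendsto_divide tendsto_minus lim lim2) simp
  have hl: "\<exists>c. (h i \<longlongrightarrow> c) (at \<mu>)" for i
  proof -
    have "((\<lambda>\<kappa>. F \<kappa> / (2 * y \<kappa>)) \<longlongrightarrow> F \<mu> / (2 * (n \<bullet> v))) (at \<mu>)"
      using b by (intro tendsto_divide tendsto_mult tendsto_const lim y) simp
    moreover have "((\<lambda>\<kappa>. - U' \<kappa> * F \<kappa> / ((y \<kappa> - V' \<kappa>) * (2 * y \<kappa>))) \<longlongrightarrow>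
        - U' \<mu> * F \<mu> / (2 * (n \<bullet> v) * (2 * (n \<bullet> v)))) (at \<mu>)"
      using b by (intro tendsto_divide tendsto_mult tendsto_minus tendsto_const lim lim1 y) simp
    ultimately show ?thesis by (cases "i = 1") (auto simp: h_def[abs_def])
  qed
  define N where "N \<kappa> = reflection_matrix a \<mu> x v \<kappa> ** lax_proj \<sigma> a x v \<kappa>" for \<kappa>
  have ev_entries: "eventually (\<lambda>\<kappa>. (\<forall>i. N \<kappa> $ i $ 2 = (\<kappa> - \<mu>) * h i \<kappa>) \<and>
      (\<forall>i. N \<kappa> $ i $ 1 = (\<kappa> - \<mu>) * (h i \<kappa> * g \<kappa>))) (at \<mu>)"
    using ev eventually_confocal_params[OF \<mu>] eventually_line_disc_pos[OF \<mu> D0]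
      eventually_neq_at_within[of \<mu> \<mu> UNIV]
  proof eventually_elim
    case (elim \<kappa>)
    define E f where "E = confocal_form a \<kappa> x x - 1"
      and "f = 2 * (v \<bullet> n) / (n \<bullet> n) / (\<kappa> - \<mu>)"
    have y0: "y \<kappa> \<noteq> 0" using elim(4) \<sigma> by (simp add: y_def)
    have "y \<kappa> * y \<kappa> = (\<sigma> * \<sigma>) * (sqrt (line_disc a x v \<kappa>) * sqrt (line_disc a x v \<kappa>))"
      by (simp only: y_def mult_ac)
    then have yy: "y \<kappa> * y \<kappa> = line_disc a x v \<kappa>" using elim(4) \<sigma> by simp
    have y1: "\<sigma> / sqrt (line_disc a x v \<kappa>) = 1 / y \<kappa>"
      using \<sigma> elim(4) by (simp add: y_def field_simps)
    have E: "E = (\<kappa> - \<mu>) * F \<kappa>"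
      using confocal_form_normal_vec[OF elim(3) \<mu> elim(5), of x x] elim(5) x
      by (simp add: E_def F_def n_def quadric_iff)
    have V': "V' \<kappa> = V \<kappa> - f * E"
      using reflected_forms(1)[OF elim(3) \<mu> elim(5) x, of v]
      by (simp add: V'_def V_def w_def n_def f_def E_def)
    have d1: "(y \<kappa> - V \<kappa>) * (y \<kappa> + V \<kappa>) = - U \<kappa> * E"
      using yy by (simp add: line_disc_def E_def U_def V_def power2_eq_square algebra_simps)
    \<comment> \<open>The reflected line has the same discriminant. Hence \<open>y + V'\<close>,
      which is what the pole turns \<open>y + V\<close> into, vanishes together with
      \<open>E\<close>.\<close>
    have "line_disc a x w \<kappa> = line_disc a x v \<kappa>"
      using line_disc_mirror[OF elim(3) \<mu> x] by (simp add: w_def n_def)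
    then have d2: "(y \<kappa> + V' \<kappa>) * (y \<kappa> - V' \<kappa>) = - U' \<kappa> * E"
      using yy by (simp add: line_disc_def E_def U'_def V'_def power2_eq_square algebra_simps)
    have P: "lax_proj \<sigma> a x v \<kappa> = mat2 ((y \<kappa> - V \<kappa>) / (2 * y \<kappa>)) (E / (2 * y \<kappa>))
        (- U \<kappa> / (2 * y \<kappa>)) ((y \<kappa> + V \<kappa>) / (2 * y \<kappa>))"
      using y0 by (simp add: lax_proj_def y1 matrix2_eq_iff lax_def mat_1_eq E_def U_def V_def field_simps)
    have R: "reflection_matrix a \<mu> x v \<kappa> = mat2 1 0 (- f) 1"
      by (simp add: reflection_matrix_def f_def n_def)
    have N12: "N \<kappa> $ 1 $ 2 = (\<kappa> - \<mu>) * h 1 \<kappa>"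
      by (simp add: N_def P R matrix2_mult_nth h_def E)
    have "N \<kappa> $ 2 $ 2 = (y \<kappa> + V' \<kappa>) / (2 * y \<kappa>)"
      by (simp add: N_def P R matrix2_mult_nth V' diff_divide_distrib add_divide_distrib)
    also have "y \<kappa> + V' \<kappa> = - U' \<kappa> * E / (y \<kappa> - V' \<kappa>)" using d2 elim(1) by (simp add: field_simps)
    finally have N22: "N \<kappa> $ 2 $ 2 = (\<kappa> - \<mu>) * h 2 \<kappa>" by (simp add: h_def E)
    have "y \<kappa> - V \<kappa> = - U \<kappa> * E / (y \<kappa> + V \<kappa>)" using d1 elim(2) by (simp add: field_simps)
    then have "(y \<kappa> - V \<kappa>) / (2 * y \<kappa>) = E / (2 * y \<kappa>) * g \<kappa>"
      by (simp add: g_def mult_ac)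
    moreover have "- U \<kappa> / (2 * y \<kappa>) = (y \<kappa> + V \<kappa>) / (2 * y \<kappa>) * g \<kappa>"
      using elim(2) y0 by (simp add: g_def)
    ultimately have P': "lax_proj \<sigma> a x v \<kappa> = mat2 (E / (2 * y \<kappa>) * g \<kappa>) (E / (2 * y \<kappa>))
        ((y \<kappa> + V \<kappa>) / (2 * y \<kappa>) * g \<kappa>) ((y \<kappa> + V \<kappa>) / (2 * y \<kappa>))"
      by (simp only: P)
    have "\<forall>i. N \<kappa> $ i $ 1 = N \<kappa> $ i $ 2 * g \<kappa>"
      unfolding forall_2 N_def P' R matrix2_mult_nth mat2_nth by (simp only: distrib_right mult.assoc)
    then show ?case using N12 N22 by (simp add: forall_2)
  qed
  have "(\<lambda>\<kappa>. N \<kappa> $ i $ j) \<in> O[at \<mu>](\<lambda>\<kappa>. \<bar>\<kappa> - \<mu>\<bar> powr 1)" for i j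
  proof -
    obtain c where c: "(h i \<longlongrightarrow> c) (at \<mu>)" using hl by blast
    show ?thesis
    proof (cases "j = 2")
      case True
      have "eventually (\<lambda>\<kappa>. N \<kappa> $ i $ j = (\<kappa> - \<mu>) * h i \<kappa>) (at \<mu>)"
        using ev_entries unfolding True by eventually_elim auto
      then show ?thesis using c by (rule bigo_order_1)
    next
      case False
      then have j: "j = 1" using exhaust_2 by blast
      have "eventually (\<lambda>\<kappa>. N \<kappa> $ i $ j = (\<kappa> - \<mu>) * (h i \<kappa> * g \<kappa>)) (at \<mu>)"
        using ev_entries unfolding j by eventually_elim auto
      then show ?thesis using tendsto_mult[OF c gl] by (rule bigo_order_1)
    qed
  qed
  then show ?thesis by (simp add: mat_bigo_def N_def \<sigma>_def n_def)
qed

lemma reflection_matrix_pole: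
  assumes "\<mu> \<in> confocal_params a" "line_disc a x v \<mu> > 0"
  shows "mat_bigo (at \<mu>) (\<lambda>\<kappa>. reflection_matrix a \<mu> x v \<kappa> ** lax_proj \<tau> a x v \<kappa>)
    (\<lambda>\<kappa>. \<bar>\<kappa> - \<mu>\<bar> powr - 1)"
proof -
  define c where "c = 2 * (v \<bullet> normal_vec a \<mu> x) / (normal_vec a \<mu> x \<bullet> normal_vec a \<mu> x)"
  have "eventually (\<lambda>\<kappa>. norm (\<kappa> - \<mu>) < 1) (at \<mu>)"
    unfolding eventually_at by (intro exI[of _ 1]) (simp add: dist_norm)
  then have "eventually (\<lambda>\<kappa>. norm (1::real) \<le> 1 * norm (\<bar>\<kappa> - \<mu>\<bar> powr - 1)) (at \<mu>)"
    using eventually_neq_at_within[of \<mu> \<mu> UNIV]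
    by eventually_elim (simp add: powr_minus field_simps)
  then have 1: "(\<lambda>_. 1) \<in> O[at \<mu>](\<lambda>\<kappa>. \<bar>\<kappa> - \<mu>\<bar> powr - 1)"
    by (rule landau_o.bigI[rotated]) simp
  \<comment> \<open>The summand 1 keeps the constant of the bound positive when \<open>c\<close> is
    zero.\<close>
  have "eventually (\<lambda>\<kappa>. norm (- (c / (\<kappa> - \<mu>))) \<le> (\<bar>c\<bar> + 1) * norm (\<bar>\<kappa> - \<mu>\<bar> powr - 1)) (at \<mu>)"
    using eventually_neq_at_within[of \<mu> \<mu> UNIV]
    by eventually_elim (simp add: powr_minus field_simps)
  then have "(\<lambda>\<kappa>. - (c / (\<kappa> - \<mu>))) \<in> O[at \<mu>](\<lambda>\<kappa>. \<bar>\<kappa> - \<mu>\<bar> powr - 1)"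
    by (rule landau_o.bigI[rotated]) simp
  then have "mat_bigo (at \<mu>) (reflection_matrix a \<mu> x v) (\<lambda>\<kappa>. \<bar>\<kappa> - \<mu>\<bar> powr - 1)"
    using 1 by (simp add: mat_bigo_def forall_2 reflection_matrix_def c_def)
  from mat_bigo_mult[OF this mat_bigo_lax_proj[OF assms]] show ?thesis by simp
qed

text \<open>The intertwining relation is \<open>reflected_forms\<close> in matrix form. At
  \<open>a $ i\<close> the lower left entry takes \<open>x $ i\<close> to the subtracted multiple of
  the normal's coordinate, which produces the mirror image.\<close>

lemma transfer_reflection:
  fixes a x v :: "real^'n"
  assumes \<mu>: "\<mu> \<in> confocal_params a" and x: "x \<in> quadric a \<mu>"
  shows "transfer a (reflection_matrix a \<mu> x v) x v x (mirror (normal_vec a \<mu> x) v)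
    (\<lambda>\<kappa>. if \<kappa> = \<mu> then sgn (normal_vec a \<mu> x \<bullet> v) else 0)"
proof -
  define n c where "n = normal_vec a \<mu> x" and "c = 2 * (v \<bullet> n) / (n \<bullet> n)"
  have R: "reflection_matrix a \<mu> x v \<kappa> = mat2 1 0 (- (c / (\<kappa> - \<mu>))) 1" for \<kappa>
    by (simp add: reflection_matrix_def c_def n_def)
  have m: "mirror n v = v - c *\<^sub>R n" by (simp add: mirror_def c_def)
  show ?thesis
    unfolding transfer_def n_def[symmetric]
  proof (intro conjI allI ballI)
    fix i j :: 2
    show "confocal_rational a (\<lambda>\<kappa>. reflection_matrix a \<mu> x v \<kappa> $ i $ j)"
      using exhaust_2[of i] exhaust_2[of j]
      by (auto simp: R intro!: confocal_rational_const confocal_rational_uminus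
          confocal_rational_inverse \<mu>)
  next
    fix \<kappa> show "det (reflection_matrix a \<mu> x v \<kappa>) = 1" by (simp add: R det_2)
  next
    have "((\<lambda>\<kappa>. - (c / (\<kappa> - \<mu>))) \<longlongrightarrow> - 0) at_top"
    proof (intro tendsto_minus tendsto_divide_0[OF tendsto_const] filterlim_at_top_imp_at_infinity)
      show "filterlim (\<lambda>\<kappa>. \<kappa> - \<mu>) at_top at_top"
        using filterlim_tendsto_add_at_top[OF tendsto_const[of "- \<mu>"] filterlim_ident] by simp
    qed
    then show "\<exists>t. \<forall>i j. ((\<lambda>\<kappa>. reflection_matrix a \<mu> x v \<kappa> $ i $ j) \<longlongrightarrow> mat2 1 t 0 1 $ i $ j) at_top"
      by (intro exI[of _ 0]) (simp add: forall_2 R)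
  next
    fix i
    show "reflection_matrix a \<mu> x v (a $ i) *v vector [x $ i, v $ i] = vector [x $ i, mirror n v $ i]"
      by (simp add: R mat2_mult_vector m) (simp add: n_def normal_vec_def)
  next
    fix \<kappa> assume "\<kappa> \<in> confocal_params a"
    then show "line_disc a x (mirror n v) \<kappa> = line_disc a x v \<kappa>"
      using line_disc_mirror \<mu> x by (simp add: n_def)
  next
    fix \<mu>' assume \<mu>': "\<mu>' \<in> confocal_params a"
    show "eventually (\<lambda>\<kappa>. reflection_matrix a \<mu> x v \<kappa> ** lax a x v \<kappa> =
        lax a x (mirror n v) \<kappa> ** reflection_matrix a \<mu> x v \<kappa>) (at \<mu>')"
      using eventually_confocal_params[OF \<mu>'] eventually_neq_at_within[of \<mu> \<mu>' UNIV]
    proof eventually_elim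
      case (elim \<kappa>)
      define f where "f = c / (\<kappa> - \<mu>)"
      note r = reflected_forms[OF elim(1) \<mu> elim(2) x, of v, folded n_def, folded c_def, folded f_def]
      show ?case
        by (simp add: R f_def[symmetric] lax_def matrix2_eq_iff matrix2_mult_nth r power2_eq_square algebra_simps)
    qed
  next
    fix \<mu>' assume \<mu>': "\<mu>' \<in> confocal_params a"
    let ?e = "if \<mu>' = \<mu> then sgn (n \<bullet> v) else 0" and ?R = "reflection_matrix a \<mu> x v"
    \<comment> \<open>Away from \<mu> there is no pole, and for a tangent line its coefficient
      \<open>c\<close> is zero.\<close>
    have regular: "mat_bigo (at \<mu>') ?R (\<lambda>_. 1)" if "\<mu>' \<noteq> \<mu> \<or> n \<bullet> v = 0"
    proof (rule mat_bigo_tendsto)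
      fix i j :: 2
      show "((\<lambda>\<kappa>. ?R \<kappa> $ i $ j) \<longlongrightarrow> ?R \<mu>' $ i $ j) (at \<mu>')"
      proof (cases "n \<bullet> v = 0")
        case True
        then show ?thesis by (simp add: R c_def inner_commute)
      next
        case False
        then have "((\<lambda>\<kappa>. - (c / (\<kappa> - \<mu>))) \<longlongrightarrow> - (c / (\<mu>' - \<mu>))) (at \<mu>')"
          using that by (intro tendsto_minus tendsto_divide tendsto_diff tendsto_const tendsto_ident_at) auto
        then show ?thesis using exhaust_2[of i] exhaust_2[of j] by (auto simp: R)
      qed
    qed
    show "if line_disc a x v \<mu>' > 0
      then mat_bigo (at \<mu>') (\<lambda>\<kappa>. ?R \<kappa> ** lax_proj 1 a x v \<kappa>) (\<lambda>\<kappa>. \<bar>\<kappa> - \<mu>'\<bar> powr ?e) \<and>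
           mat_bigo (at \<mu>') (\<lambda>\<kappa>. ?R \<kappa> ** lax_proj (- 1) a x v \<kappa>) (\<lambda>\<kappa>. \<bar>\<kappa> - \<mu>'\<bar> powr - ?e)
      else mat_bigo (at \<mu>') ?R (\<lambda>_. 1)"
    proof (cases "\<mu>' \<noteq> \<mu> \<or> n \<bullet> v = 0")
      case True
      then have "?e = 0" by auto
      then show ?thesis
        using regular[OF True] mat_bigo_regular[OF regular[OF True] \<mu>'] by (simp del: powr_zero_eq_one)
    next
      case False
      then have b: "\<mu>' = \<mu>" "n \<bullet> v \<noteq> 0" by auto
      have D: "line_disc a x v \<mu> > 0" using line_disc_at[OF x, of v] b(2) by (simp add: n_def)
      note zero = reflection_matrix_zero[OF \<mu> x, of v, folded n_def, OF b(2)]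
        and pole = reflection_matrix_pole[OF \<mu> D]
      show ?thesis
      proof (cases "n \<bullet> v > 0")
        case True
        then show ?thesis using zero pole[of "- 1"] D b by simp
      next
        case False
        then have "sgn (n \<bullet> v) = - 1" using b by simp
        then show ?thesis using zero pole[of 1] D b by simp
      qed
    qed
  qed
qed

section \<open>Divisors of trajectories\<close>

text \<open>The choice is immaterial, because \<open>transfer_shift\<close> leads from one point of
  the line to any other with divisor zero.\<close>

definition base_point :: "('n::finite) dline \<Rightarrow> real^'n" where
  "base_point l = (SOME x. x \<in> fst l)"

lemma base_point: "is_dline l \<Longrightarrow> base_point l \<in> fst l"
  unfolding base_point_def is_dline_def is_line_def
  by (metis aff_dim_empty_eq equals0I one_neq_neg_one some_in_eq)

definition line_transfer :: "real^'n \<Rightarrow> 'n dline \<Rightarrow> 'n dline \<Rightarrow> (real \<Rightarrow> real) \<Rightarrow> bool" where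
  "line_transfer a l m e \<longleftrightarrow>
     (\<exists>M. transfer a M (base_point l) (snd l) (base_point m) (snd m) e)"

lemma line_transfer_refl: "line_transfer a l l (\<lambda>_. 0)"
  using transfer_shift[of a 0 "base_point l" "snd l"] by (auto simp: line_transfer_def)

lemma line_transfer_trans:
  "line_transfer a k l e \<Longrightarrow> line_transfer a l m f \<Longrightarrow> line_transfer a k m (\<lambda>\<mu>. e \<mu> + f \<mu>)"
  unfolding line_transfer_def using transfer_compose by blast

lemma line_transfer_sym: "line_transfer a l m e \<Longrightarrow> line_transfer a m l (\<lambda>\<mu>. - e \<mu>)"
  unfolding line_transfer_def using transfer_inverse by blast

lemma line_transfer_reflects:
  assumes "reflects a l m e"
  shows "line_transfer a l m e"
proof -
  obtain \<mu> P where \<mu>: "\<mu> \<in> confocal_params a" and P: "dreflection_law a \<mu> P l m"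
    and e: "e = (\<lambda>\<kappa>. if \<kappa> = \<mu> then sgn (normal_vec a \<mu> P \<bullet> snd l) else 0)"
    using assms unfolding reflects_def by blast
  note p = dreflection_lawD[OF P]
  obtain s where "P - base_point l = s *\<^sub>R snd l" using dline_diff[OF p(1,4) base_point[OF p(1)]] .
  then have s: "P = base_point l + s *\<^sub>R snd l" by (simp add: diff_eq_eq add.commute)
  obtain t where "base_point m - P = t *\<^sub>R snd m" using dline_diff[OF p(2) base_point[OF p(2)] p(5)] .
  then have t: "base_point m = P + t *\<^sub>R snd m" by (simp add: diff_eq_eq add.commute)
  \<comment> \<open>The base point is moved to the point of reflection, the line is reflected there,
    and the point is moved on to the base point of \<open>m\<close>.\<close>
  have 1: "transfer a (\<lambda>_. mat2 1 s 0 1) (base_point l) (snd l) P (snd l) (\<lambda>_. 0)"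
    using transfer_shift[of a s "base_point l" "snd l"] s by simp
  have 2: "transfer a (reflection_matrix a \<mu> P (snd l)) P (snd l) P (snd m) e"
    using transfer_reflection[OF \<mu> p(3), of "snd l"] p(6) e by simp
  have 3: "transfer a (\<lambda>_. mat2 1 t 0 1) P (snd m) (base_point m) (snd m) (\<lambda>_. 0)"
    using transfer_shift[of a t P "snd m"] t by simp
  show ?thesis
    unfolding line_transfer_def using transfer_compose[OF transfer_compose[OF 1 2] 3] by auto
qed

lemma line_transfer_trivial_divisor:
  assumes "line_transfer a l m e" "\<And>\<mu>. e \<mu> = 0" "is_dline l" "is_dline m"
  shows "l = m"
proof -
  obtain M where "transfer a M (base_point l) (snd l) (base_point m) (snd m) e"
    using assms(1) by (auto simp: line_transfer_def)
  then obtain t where t: "snd m = snd l" "base_point m = base_point l + t *\<^sub>R snd l"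
    using transfer_trivial_divisor assms(2) by metis
  then have "base_point m \<in> fst l"
    using dline_eq[OF assms(3) base_point[OF assms(3)]] by auto
  then have "fst l = fst m"
    using dline_eq[OF assms(3), of "base_point m"] dline_eq[OF assms(4) base_point[OF assms(4)]] t(1)
    by simp
  then show ?thesis using t(1) by (simp add: prod_eq_iff)
qed

text \<open>\<open>reflects_unique\<close> leaves at most one candidate when \<open>l\<close> is
  touching. Being a function of the two lines alone, it can be summed over the multiset of a
  tuple.\<close>

definition reflection_divisor :: "real^'n \<Rightarrow> 'n dline \<Rightarrow> 'n dline \<Rightarrow> real \<Rightarrow> real" where
  "reflection_divisor a l m = (SOME e. reflects a l m e)"

lemma trajectory_reflects:
  assumes "t \<in> trajectories a A l" "Suc i < length t"
  obtains e where "reflects a (t ! i) (t ! Suc i) e"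
  using assms unfolding trajectories_def reflects_def by blast

lemma trajectory_touching:
  assumes "t \<in> trajectories a A l" "touching a l" "i < length t"
  shows "touching a (t ! i)"
  using assms(3)
proof (induction i)
  case 0
  then show ?case using assms by (auto simp: trajectories_def hd_conv_nth)
next
  case (Suc i)
  then obtain \<mu> P where "\<mu> \<in> confocal_params a" "dreflection_law a \<mu> P (t ! i) (t ! Suc i)"
    using assms(1) by (auto simp: trajectories_def)
  moreover have "touching a (t ! i)" using Suc by simp
  ultimately show ?case using touching_dreflection[of a "t ! i" \<mu> P "t ! Suc i"] by blast
qed

text \<open>Each step of a trajectory has the same divisor as the reflection from the initial line to the
  corresponding line of the tuple, since opposite reflections of a configuration do.\<close>

lemma dtuple_line_transfer:
  fixes a :: "real^'n"
  assumes inj: "inj (\<lambda>i. a $ i)" and t: "t \<in> trajectories a A l" and l: "touching a l"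
    and ds: "dtuple a t ds"
  shows "line_transfer a l (last t) (\<lambda>\<mu>. \<Sum>d\<in>#mset ds. reflection_divisor a l d \<mu>)"
proof -
  define n where "n = traj_length t"
  have t0: "t \<noteq> []" "length t = Suc n" "t ! 0 = l" "length ds = n"
    using t ds by (auto simp: trajectories_def n_def traj_length_def dtuple_def hd_conv_nth)
  obtain L where L: "\<And>k. k \<in> {1..n} \<Longrightarrow> L k k = t ! k"
    "\<And>k j. k \<in> {1..n} \<Longrightarrow> j \<in> {1..<k} \<Longrightarrow> drc_completion a (t ! (j - 1)) (t ! j) (L k (Suc j)) (L k j)"
    "\<And>k. k \<in> {1..n} \<Longrightarrow> ds ! (k - 1) = L k 1"
    using ds unfolding dtuple_def n_def by blast
  have step: "reflects a (t ! k) (t ! Suc k) (reflection_divisor a l (ds ! k))" if k: "k < n" for k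
  proof -
    obtain e where e: "reflects a (t ! k) (t ! Suc k) e" using trajectory_reflects[OF t, of k] k t0(2) by auto
    have "reflects a (t ! (k - i)) (L (Suc k) (Suc (k - i))) e" if "i \<le> k" for i
      using that
    proof (induction i)
      case 0
      then show ?case using e L(1)[of "Suc k"] k by simp
    next
      case (Suc i)
      define j where "j = k - i"
      have j: "j \<in> {1..<Suc k}" "Suc (k - Suc i) = j" "k - Suc i = j - 1" using Suc.prems by (auto simp: j_def)
      have drc: "drc a (t ! j) (t ! (j - 1)) (L (Suc k) (Suc j)) (L (Suc k) j)"
        using L(2)[of "Suc k" j] j(1) k unfolding drc_completion_def by auto
      have tj: "touching a (t ! j)" using trajectory_touching[OF t l] j k t0(2) by auto
      obtain e' where "reflects a (t ! j) (L (Suc k) (Suc j)) e'" "reflects a (t ! (j - 1)) (L (Suc k) j) e'"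
        using drc_reflects[OF inj tj drc] by blast
      moreover have "reflects a (t ! j) (L (Suc k) (Suc j)) e" using Suc by (simp add: j_def)
      ultimately have "reflects a (t ! (j - 1)) (L (Suc k) j) e"
        using reflects_unique[OF inj tj] by blast
      then show ?case using j(2,3) by simp
    qed
    \<comment> \<open>For \<open>i = k\<close> the first line is the initial line \<open>l\<close>.
      Lists count from 0, so the line with lower index \<open>Suc k\<close> and upper index 1 is
      \<open>ds ! k\<close>.\<close>
    from this[of k] have "reflects a l (ds ! k) e" using L(3)[of "Suc k"] k t0(3) by simp
    moreover from this have "reflects a l (ds ! k) (reflection_divisor a l (ds ! k))"
      unfolding reflection_divisor_def by (rule someI[of "reflects a l (ds ! k)"])
    ultimately show ?thesis using reflects_unique[OF inj l] e by blast
  qed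
  have "line_transfer a l (t ! m) (\<lambda>\<mu>. \<Sum>k<m. reflection_divisor a l (ds ! k) \<mu>)" if "m \<le> n" for m
    using that
  proof (induction m)
    case 0
    then show ?case using line_transfer_refl[of a l] t0(3) by simp
  next
    case (Suc m)
    then show ?case using line_transfer_trans[OF _ line_transfer_reflects[OF step[of m]]] by simp
  qed
  from this[of n] have "line_transfer a l (t ! n) (\<lambda>\<mu>. \<Sum>k<n. reflection_divisor a l (ds ! k) \<mu>)" by simp
  moreover have "t ! n = last t" using t0(1,2) by (simp add: last_conv_nth)
  moreover have "(\<Sum>d\<in>#mset ds. reflection_divisor a l d \<mu>) = (\<Sum>k<n. reflection_divisor a l (ds ! k) \<mu>)" for \<mu>
    unfolding mset_map[symmetric] sum_mset_sum_list
    using t0(4) by (simp add: sum_list_sum_nth atLeast0LessThan)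
  ultimately show ?thesis by simp
qed

section \<open>The one-dimensional case\<close>

text \<open>Here no quadric has to be touched, the only line is a coordinate axis, and a reflection does not
  determine its quadric; but the direction just alternates.\<close>

lemma mirror_one_dim:
  fixes n u :: "real^'n"
  assumes "CARD('n) = 1" "n \<noteq> 0"
  shows "mirror n u = - u"
proof -
  obtain i :: 'n where i: "UNIV = {i}" using assms(1) by (auto simp: card_1_singleton_iff)
  have j: "j = i" for j using UNIV_I[of j] unfolding i by simp
  have inner: "x \<bullet> y = x $ i * y $ i" for x y :: "real^'n" by (simp add: inner_vec_def i)
  have "n $ i \<noteq> 0" using assms(2) j by (metis vec_eq_iff zero_index)
  then have "mirror n u $ i = (- u) $ i" by (simp add: mirror_def inner)
  then show ?thesis using j by (metis vec_eq_iff)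
qed

lemma trajectory_one_dim:
  fixes a :: "real^'n"
  assumes d: "CARD('n) = 1" and t: "t \<in> trajectories a A l" and i: "i < length t"
  shows "t ! i = (UNIV, ((-1) ^ i) *\<^sub>R snd l)"
proof -
  have "snd (t ! i) = ((-1) ^ i) *\<^sub>R snd l"
    using i
  proof (induction i)
    case 0
    then show ?case using t by (auto simp: trajectories_def hd_conv_nth)
  next
    case (Suc i)
    then obtain \<mu> P where P: "dreflection_law a \<mu> P (t ! i) (t ! Suc i)"
      using t by (auto simp: trajectories_def)
    show ?case
      using dreflection_lawD(6)[OF P] mirror_one_dim[OF d normal_vec_nonzero[OF dreflection_lawD(3)[OF P]]] Suc
      by simp
  qed
  moreover have "fst (t ! i) = UNIV"
  proof -
    have "is_line (fst (t ! i))" using t i by (auto simp: trajectories_def is_dline_def)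
    then have "affine hull (fst (t ! i)) = fst (t ! i)" "aff_dim (fst (t ! i)) = int DIM(real^'n)"
      using d by (simp_all add: is_line_def affine_hull_eq)
    then show ?thesis using aff_dim_eq_full by metis
  qed
  ultimately show ?thesis by (simp add: prod_eq_iff)
qed

theorem proposition8:
  fixes a :: "real^'n" and A :: "real set" and l :: "(real^'n) set"
    and l0 :: "'n dline" and t1 t1' t2 t2' s s' :: "'n dline list"
  assumes "inj (\<lambda>i. a $ i)"
    and "finite A" and "card A = CARD('n) - 1" and "A \<subseteq> confocal_params a"
    and "l \<in> common_tangent_lines a A"
    and "is_dline l0" and "fst l0 \<in> common_tangent_lines a A"
    and "t1 \<in> trajectories a A l0" and "t1' \<in> trajectories a A l0"
    and "t2 \<in> trajectories a A l0" and "t2' \<in> trajectories a A l0"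
    and "beta_equiv t1 t1'" and "beta_equiv t2 t2'"
    and "is_sum a A l0 t1 t2 s" and "is_sum a A l0 t1' t2' s'"
  shows "beta_equiv s s'"
proof -
  obtain ds1 ds2 ds where s: "s \<in> trajectories a A l0"
    and ds: "dtuple a t1 ds1" "dtuple a t2 ds2" "dtuple a s ds" "mset ds = mset ds1 + mset ds2"
    using assms(14) unfolding is_sum_def by auto
  obtain ds1' ds2' ds' where s': "s' \<in> trajectories a A l0"
    and ds': "dtuple a t1' ds1'" "dtuple a t2' ds2'" "dtuple a s' ds'" "mset ds' = mset ds1' + mset ds2'"
    using assms(15) unfolding is_sum_def by auto
  have ne: "s \<noteq> []" "s' \<noteq> []" and hd: "hd s = l0" "hd s' = l0"
    using s s' by (auto simp: trajectories_def)
  have "length ds = length ds1 + length ds2" "length ds' = length ds1' + length ds2'"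
    using ds(4) ds'(4) by (metis size_mset size_union)+
  then have len: "traj_length s = traj_length s'"
    using ds ds' assms(12,13) by (auto simp: dtuple_def beta_equiv_def)
  have "last s = last s'"
  proof (cases "CARD('n) = 1")
    case True
    have "length s = length s'" using len ne by (cases s; cases s') (auto simp: traj_length_def)
    then show ?thesis
      using trajectory_one_dim[OF True s, of "length s - 1"] trajectory_one_dim[OF True s', of "length s - 1"] ne
      by (simp add: last_conv_nth)
  next
    case False
    \<comment> \<open>From dimension two on, some quadric is touched by the initial line; a single
      one suffices for \<open>touching\<close>.\<close>
    then have "CARD('n) - 1 > 0" using zero_less_card_finite[where 'a = 'n] by linarith
    then have "A \<noteq> {}" using assms(3) by auto
    then obtain \<alpha> where "\<alpha> \<in> A" by blast
    then have \<alpha>: "\<alpha> \<in> confocal_params a" "tangent_to_quadric a \<alpha> (fst l0)"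
      using assms(4,7) by (auto simp: common_tangent_lines_def)
    then have l0: "touching a l0"
      using tangent_line_disc[OF assms(6) \<alpha>] assms(6) by (auto simp: touching_def)
    define E where "E ds \<mu> = (\<Sum>d\<in>#mset ds. reflection_divisor a l0 d \<mu>)" for ds \<mu>
    note T = dtuple_line_transfer[OF assms(1) _ l0, folded E_def]
    have E: "E ds \<mu> = E ds1 \<mu> + E ds2 \<mu>" "E ds' \<mu> = E ds1' \<mu> + E ds2' \<mu>" for \<mu>
      using ds(4) ds'(4) by (simp_all add: E_def)
    have last: "last t1 = last t1'" "last t2 = last t2'" using assms(12,13) by (auto simp: beta_equiv_def)
    \<comment> \<open>A loop at \<open>l0\<close>: forward along \<open>t1'\<close> and back along
      \<open>t1\<close>, which has the same final segment. Its divisor need not vanish.\<close>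
    have 1: "line_transfer a l0 l0 (\<lambda>\<mu>. E ds1' \<mu> + - E ds1 \<mu>)"
      by (rule line_transfer_trans[OF T[OF assms(9) ds'(1)]
            line_transfer_sym[OF T[OF assms(8) ds(1), unfolded last(1)]]])
    have 2: "line_transfer a l0 l0 (\<lambda>\<mu>. E ds2' \<mu> + - E ds2 \<mu>)"
      by (rule line_transfer_trans[OF T[OF assms(11) ds'(2)]
            line_transfer_sym[OF T[OF assms(10) ds(2), unfolded last(2)]]])
    \<comment> \<open>The path leads from the end of \<open>s'\<close> back to \<open>l0\<close>,
      around both loops, and on to the end of \<open>s\<close>. Its divisor
      \<open>- E ds' + (E ds1' - E ds1) + (E ds2' - E ds2) + E ds\<close> is zero by the additivity
      \<open>E\<close>.\<close>
    note line_transfer_trans[OF line_transfer_trans[OF line_transfer_trans[OF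
          line_transfer_sym[OF T[OF s' ds'(3)]] 1] 2] T[OF s ds(3)]]
    moreover have "is_dline (last s)" "is_dline (last s')"
      using s s' ne by (auto simp: trajectories_def)
    ultimately have "last s' = last s"
      by (elim line_transfer_trivial_divisor) (simp_all add: E)
    then show ?thesis by simp
  qed
  then show ?thesis using hd len by (simp add: beta_equiv_def)
qed

end
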